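(* Let $k\geq 7$ be an odd integer and let $T\in\mathcal{D}_k\setminus\mathcal{D}_{k-2}$. Then $T$ is switching equivalent to a transitive blowup of $L_{k+1}$ if and only if $T\in\xi(L_{k+1})$, i.e. if and only if $T$ contains a subtournament which is switching isomorphic to $L_{k+1}$.
   Context: A tournament is a digraph with exactly one arc between each pair of distinct vertices. Skew-adjacency matrix $S_T$ w.r.t. an ordering $v_1,\dots,v_n$: entry $1$ if $v_i\to v_j$, $-1$ if $v_j\to v_i$, $0$ on the diagonal; $\det(T)=\det(S_T)$. For odd $k\ge1$, $\mathcal{D}_k$ is the set of tournaments all of whose induced subtournaments have determinant at most $k^2$; $T\in\mathcal{D}_k\setminus\mathcal{D}_{k-2}$ means $T\in\mathcal{D}_k$ and $T\notin\mathcal{D}_{k-2}$. The switch of $T$ with respect to $W\subseteq V(T)$ reverses all arcs between $W$ and $V(T)\setminus W$; $T$ and its switches are switching equivalent; $T_1$ is switching isomorphic to $T_2$ if some switch of $T_1$ is isomorphic to $T_2$. $\xi(H)$ denotes the set of tournaments containing a subtournament switching isomorphic to $H$. For $n\ge2$, $L_n$ is the $n$-tournament on $v_1,\dots,v_n$ with $v_i\to v_j$ for $1\le i<j\le n-1$, and for $1\le i\le n-1$, $v_n\to v_i$ if $i$ is odd, $v_i\to v_n$ if $i$ is even. A transitive blowup of a tournament $H$ on $h_1,\dots,h_m$ replaces each $h_i$ by a transitive tournament on $a_i\ge1$ vertices with all arcs from block $i$ to block $j$ whenever $h_i\to h_j$. "$T$ is switching equivalent to a transitive blowup of $H$" means some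 switch of $T$ is isomorphic to a transitive blowup of $H$. *)

theory Defs
  imports
    "Jordan_Normal_Form.Determinant"
    "Graph_Theory.Pair_Digraph"
    "Graph_Theory.Digraph_Isomorphism"
begin

locale tournament = pair_digraph T for T :: "'a pair_pre_digraph" +
  assumes exactly_one_arc:
    "\<lbrakk>u \<in> pverts T; v \<in> pverts T; u \<noteq> v\<rbrakk> \<Longrightarrow> (u, v) \<in> parcs T \<longleftrightarrow> (v, u) \<notin> parcs T"

definition subtournament :: "'a pair_pre_digraph \<Rightarrow> 'a pair_pre_digraph \<Rightarrow> bool" where
  "subtournament S T \<longleftrightarrow> induced_subgraph (with_proj S) (with_proj T)"

definition isomorphic :: "'a pair_pre_digraph \<Rightarrow> 'b pair_pre_digraph \<Rightarrow> bool" where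
  "isomorphic S T \<longleftrightarrow> digraph_iso (with_proj S) (with_proj T)"

definition skew_adjacency :: "'a pair_pre_digraph \<Rightarrow> 'a list \<Rightarrow> int mat" where
  "skew_adjacency T vs = mat (length vs) (length vs)
     (\<lambda>(i, j). if (vs ! i, vs ! j) \<in> parcs T then 1
               else if (vs ! j, vs ! i) \<in> parcs T then -1 else 0)"

definition vertex_ordering :: "'a pair_pre_digraph \<Rightarrow> 'a list \<Rightarrow> bool" where
  "vertex_ordering T vs \<longleftrightarrow> distinct vs \<and> set vs = pverts T"

text \<open>The choice of the ordering is immaterial, see \<open>tournament_det_eq\<close> below.\<close>

definition tournament_det :: "'a pair_pre_digraph \<Rightarrow> int" where
  "tournament_det T = det (skew_adjacency T (SOME vs. vertex_ordering T vs))"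

definition tournaments_D :: "nat \<Rightarrow> 'a pair_pre_digraph set" where
  "tournaments_D k = {T. tournament T \<and> (\<forall>S. subtournament S T \<longrightarrow> tournament_det S \<le> (int k)\<^sup>2)}"

definition switch :: "'a pair_pre_digraph \<Rightarrow> 'a set \<Rightarrow> 'a pair_pre_digraph" where
  "switch T W = \<lparr> pverts = pverts T,
     parcs = {(u, v). (u, v) \<in> parcs T \<and> (u \<in> W \<longleftrightarrow> v \<in> W)}
           \<union> {(u, v). (v, u) \<in> parcs T \<and> (u \<in> W \<longleftrightarrow> v \<notin> W)} \<rparr>"

definition switching_equivalent :: "'a pair_pre_digraph \<Rightarrow> 'a pair_pre_digraph \<Rightarrow> bool" where
  "switching_equivalent T T' \<longleftrightarrow> (\<exists>W \<subseteq> pverts T. T' = switch T W)"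

definition switching_isomorphic :: "'a pair_pre_digraph \<Rightarrow> 'b pair_pre_digraph \<Rightarrow> bool" where
  "switching_isomorphic T\<^sub>1 T\<^sub>2 \<longleftrightarrow> (\<exists>T'. switching_equivalent T\<^sub>1 T' \<and> isomorphic T' T\<^sub>2)"

definition xi :: "'b pair_pre_digraph \<Rightarrow> 'a pair_pre_digraph set" where
  "xi H = {T. tournament T \<and> (\<exists>S. subtournament S T \<and> switching_isomorphic S H)}"

text \<open>Meaningful for \<open>n \<ge> 2\<close> only.\<close>

definition L :: "nat \<Rightarrow> nat pair_pre_digraph" where
  "L n = \<lparr> pverts = {1..n},
     parcs = {(i, j). 1 \<le> i \<and> i < j \<and> j \<le> n - 1}
           \<union> {(n, i) | i. 1 \<le> i \<and> i \<le> n - 1 \<and> odd i}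
           \<union> {(i, n) | i. 1 \<le> i \<and> i \<le> n - 1 \<and> even i} \<rparr>"

definition blowup :: "'b pair_pre_digraph \<Rightarrow> ('b \<Rightarrow> nat) \<Rightarrow> ('b \<times> nat) pair_pre_digraph" where
  "blowup H a = \<lparr> pverts = {(h, i). h \<in> pverts H \<and> i < a h},
     parcs = {((h, i), (h', j)). h \<in> pverts H \<and> h' \<in> pverts H \<and> i < a h \<and> j < a h' \<and>
                ((h, h') \<in> parcs H \<or> h = h' \<and> i < j)} \<rparr>"

definition transitive_blowup_of :: "'a pair_pre_digraph \<Rightarrow> 'b pair_pre_digraph \<Rightarrow> bool" where
  "transitive_blowup_of B H \<longleftrightarrow> (\<exists>a. (\<forall>h \<in> pverts H. a h \<ge> 1) \<and> isomorphic B (blowup H a))"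


lemma det_skew_adjacency_ordering:
  assumes "vertex_ordering T vs" "vertex_ordering T ws"
  shows "det (skew_adjacency T vs) = det (skew_adjacency T ws)"
proof -
  let ?n = "length ws"
  have d: "distinct vs" "distinct ws" "set vs = set ws"
    using assms by (auto simp: vertex_ordering_def)
  have len: "length vs = ?n"
    using d by (metis distinct_card)
  have "mset vs = mset ws"
    using d by (simp add: set_eq_iff_mset_eq_distinct)
  then obtain p where p: "p permutes {..<?n}" "permute_list p ws = vs"
    using mset_eq_permutation by blast
  have p0: "p permutes {0..<?n}" using p(1) by (simp add: lessThan_atLeast0)
  have nth: "vs ! i = ws ! p i" if "i < ?n" for i
    using that p permute_list_nth by metis
  have lt: "p i < ?n \<longleftrightarrow> i < ?n" for i
    using permutes_in_image[OF p(1), of i] by simp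
  define A where "A = skew_adjacency T ws"
  have A: "A \<in> carrier_mat ?n ?n" by (simp add: A_def skew_adjacency_def)
  define B where "B = mat ?n ?n (\<lambda>(i,j). A $$ (p i, j))"
  have B: "B \<in> carrier_mat ?n ?n" by (simp add: B_def)
  have dB: "det B = signof p * det A"
    unfolding B_def by (rule det_permute_rows[OF A p0])
  have "skew_adjacency T vs = transpose_mat (mat ?n ?n (\<lambda>(i,j). transpose_mat B $$ (p i, j)))"
    by (rule eq_matI) (auto simp: skew_adjacency_def A_def B_def len nth lt)
  then have "det (skew_adjacency T vs) = det (mat ?n ?n (\<lambda>(i,j). transpose_mat B $$ (p i, j)))"
    by (metis det_transpose mat_carrier)
  also have "\<dots> = signof p * det (transpose_mat B)"
    by (rule det_permute_rows[OF _ p0]) (use B in simp)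
  also have "\<dots> = (signof p * signof p) * det A"
    using det_transpose[OF B] dB by simp
  also have "signof p * signof p = (1::int)"
    by (simp add: sign_def)
  finally show ?thesis by (simp add: A_def)
qed

lemma tournament_det_eq:
  assumes "vertex_ordering T vs"
  shows "tournament_det T = det (skew_adjacency T vs)"
  unfolding tournament_det_def
  by (rule det_skew_adjacency_ordering[OF someI assms]) (rule assms)

lemma (in tournament) arcs_total:
  "\<lbrakk>u \<in> pverts T; v \<in> pverts T; u \<noteq> v\<rbrakk> \<Longrightarrow> (u, v) \<in> parcs T \<or> (v, u) \<in> parcs T"
  using exactly_one_arc[of u v] by simp

lemma (in tournament) arcs_asym: "(u, v) \<in> parcs T \<Longrightarrow> (v, u) \<notin> parcs T"
  using exactly_one_arc[of u v] in_arcsD1[of u v] in_arcsD2[of u v] no_loops'[of u v] by simp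

lemma tournamentI:
  assumes fin: "finite (pverts T)"
    and wf: "\<And>u v. (u, v) \<in> parcs T \<Longrightarrow> u \<in> pverts T \<and> v \<in> pverts T"
    and total: "\<And>u v. \<lbrakk>u \<in> pverts T; v \<in> pverts T; u \<noteq> v\<rbrakk> \<Longrightarrow> (u, v) \<in> parcs T \<or> (v, u) \<in> parcs T"
    and asym: "\<And>u v. (u, v) \<in> parcs T \<Longrightarrow> (v, u) \<notin> parcs T"
  shows "tournament T"
proof
  have "parcs T \<subseteq> pverts T \<times> pverts T" using wf by auto
  then show "finite (parcs T)" using fin finite_subset by blast
  show "(u, v) \<in> parcs T \<longleftrightarrow> (v, u) \<notin> parcs T"
    if "u \<in> pverts T" "v \<in> pverts T" "u \<noteq> v" for u v
    using total[OF that] asym by blast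
  show "fst e \<in> pverts T" "snd e \<in> pverts T" if "e \<in> parcs T" for e
    using that wf[of "fst e" "snd e"] by auto
  show "fst e \<noteq> snd e" if "e \<in> parcs T" for e
    using that asym[of "fst e" "snd e"] by (metis prod.collapse)
qed (fact fin)

lemma tournament_L:
  assumes "n \<ge> 2"
  shows "tournament (L n)"
proof (rule tournamentI)
  have le: "i \<le> n - 1 \<longleftrightarrow> i < n" for i
    using assms by auto
  have arc: "(u, v) \<in> parcs (L n) \<longleftrightarrow>
      1 \<le> u \<and> u < v \<and> v < n \<or> u = n \<and> 1 \<le> v \<and> v < n \<and> odd v \<or> v = n \<and> 1 \<le> u \<and> u < n \<and> even u"
    for u v
    unfolding L_def le by auto
  have vert: "u \<in> pverts (L n) \<longleftrightarrow> 1 \<le> u \<and> u \<le> n" for u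
    by (simp add: L_def)
  show "u \<in> pverts (L n) \<and> v \<in> pverts (L n)" if "(u, v) \<in> parcs (L n)" for u v
    using that assms unfolding arc vert by (elim disjE) auto
  show "(u, v) \<in> parcs (L n) \<or> (v, u) \<in> parcs (L n)"
    if "u \<in> pverts (L n)" "v \<in> pverts (L n)" "u \<noteq> v" for u v
    using that unfolding arc vert by (metis le_neq_implies_less linorder_neqE_nat)
  show "(v, u) \<notin> parcs (L n)" if "(u, v) \<in> parcs (L n)" for u v
    using that unfolding arc by (metis less_asym)
qed (simp add: L_def)

lemma tournament_switch:
  assumes "tournament T"
  shows "tournament (switch T W)"
proof -
  interpret tournament T by fact
  show ?thesis
  proof (rule tournamentI)
    show "(u, v) \<in> parcs (switch T W) \<or> (v, u) \<in> parcs (switch T W)"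
      if "u \<in> pverts (switch T W)" "v \<in> pverts (switch T W)" "u \<noteq> v" for u v
      using arcs_total[of u v] that by (auto simp: switch_def)
  qed (auto simp: switch_def dest: in_arcsD1 in_arcsD2 arcs_asym)
qed

lemma tournament_blowup:
  assumes "tournament H"
  shows "tournament (blowup H a)"
proof -
  interpret tournament H by fact
  have "pverts (blowup H a) = (SIGMA h:pverts H. {..<a h})" by (auto simp: blowup_def)
  then have "finite (pverts (blowup H a))" by simp
  then show ?thesis
  proof (rule tournamentI)
    show "(u, v) \<in> parcs (blowup H a) \<or> (v, u) \<in> parcs (blowup H a)"
      if "u \<in> pverts (blowup H a)" "v \<in> pverts (blowup H a)" "u \<noteq> v" for u v
      using arcs_total[of "fst u" "fst v"] that
      by (cases u; cases v; cases "fst u = fst v") (auto simp: blowup_def)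
  qed (auto simp: blowup_def dest: arcs_asym)
qed

lemma tournament_subtournament:
  assumes "tournament T" "subtournament S T"
  shows "tournament S"
proof -
  interpret tournament T by fact
  have S: "pverts S \<subseteq> pverts T" "parcs S = {e \<in> parcs T. fst e \<in> pverts S \<and> snd e \<in> pverts S}"
    using assms(2) by (auto simp: subtournament_def induced_subgraph_def subgraph_def)
  then have "finite (pverts S)" using finite_subset pair_finite_verts by blast
  then show ?thesis
  proof (rule tournamentI)
    show "(u, v) \<in> parcs S \<or> (v, u) \<in> parcs S"
      if "u \<in> pverts S" "v \<in> pverts S" "u \<noteq> v" for u v
      using arcs_total[of u v] that S by auto
  qed (use S arcs_asym in auto)
qed

end

theory Submission
  imports Defs
begin

text \<open>The bound k^2 is attained by \<open>core\<close> on {..k}, and skew symmetry makes every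
  ratio of determinants that occurs a square; so each replaced or enlarged copy yields a bound of
  the form "absolute value at most 1". A copy of \<open>L (k - 1)\<close> has determinant (k - 2)^2,
  and the corresponding bound is only k / (k - 2); after scaling the solution by the size of the
  cycle, both cases read "absolute value at most k".

  The smaller copies cannot be dispensed with: the bounds from the full copy admit sign patterns
  whose adjacent plus pairs are spread evenly. For k = 9 the signs \<open>++-++-++-\<close> around
  the cycle give a walk with steps -12, 6, 6 repeated, which fits into [-9, 9] although it belongs
  to no twin. Deleting a plus pair lowers the sum of the signs by 2 and brings two minus signs
  together, while the permitted range stays the same; this is what excludes such patterns.

  Since \<open>core\<close> does not depend on m, the smaller copy is obtained by dropping the last
  two vertices, and the rotations move any adjacent pair there.\<close>

text \<open>Up to switching, \<open>L (k + 1)\<close> is a source together with the regular locally transitive tournament on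
  \<open>k\<close> vertices, and its determinant is \<open>k\<^sup>2\<close>. If \<open>S\<close> is its skew-adjacency matrix and \<open>x = S u\<close> is the
  vector of arcs to a further vertex, then replacing vertex \<open>i\<close> by this vertex multiplies the determinant
  by \<open>(u i)\<^sup>2\<close>, so \<open>\<bar>u i\<bar> \<le> 1\<close> for all \<open>i\<close>. Adding cyclically adjacent rows of \<open>S u = x\<close> turns this into bounds
  on a walk with steps determined by \<open>x\<close>; together with the same bounds for the copies of
  \<open>L (k - 1)\<close> inside \<open>L (k + 1)\<close> they force \<open>x\<close> to be, up to sign, a twin of some vertex. Adding two twins
  multiplies the determinant by the square of an explicit expression; its being at most \<open>1\<close> forces twins of distinct
  vertices to be joined like these vertices, and rules out 3-cycles among the twins of one vertex. Hence
  the classes of twins form a transitive blowup.\<close>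

section \<open>Determinants of skew-symmetric matrices\<close>

text \<open>Rational entries, since systems with these matrices are solved below; indexing by
  functions lets one \<open>core\<close> serve all sizes.\<close>

abbreviation fdet :: "nat \<Rightarrow> (nat \<Rightarrow> nat \<Rightarrow> rat) \<Rightarrow> rat" where
  "fdet n M \<equiv> det (mat n n (\<lambda>(i, j). M i j))"

lemma fdet_cong:
  assumes "\<And>i j. i < n \<Longrightarrow> j < n \<Longrightarrow> M i j = N i j"
  shows "fdet n M = fdet n N"
  by (rule arg_cong[of _ _ det], rule cong_mat) (use assms in auto)

lemma fdet_solution:
  assumes "fdet n M \<noteq> 0"
  obtains u where "\<And>i. i < n \<Longrightarrow> (\<Sum>j<n. M i j * u j) = x i"
proof -
  let ?A = "mat n n (\<lambda>(i, j). M i j)"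
  have "?A \<in> Units (ring_mat TYPE(rat) n ())"
    by (rule det_non_zero_imp_unit) (use assms in auto)
  then obtain B where B: "B \<in> carrier_mat n n" "?A * B = 1\<^sub>m n"
    by (auto simp: Units_def ring_mat_def)
  define v where "v = B *\<^sub>v vec n x"
  have v: "v \<in> carrier_vec n" using B by (simp add: v_def)
  have "?A *\<^sub>v v = (?A * B) *\<^sub>v vec n x"
    unfolding v_def using B by (intro assoc_mult_mat_vec[symmetric]) auto
  also have "\<dots> = vec n x" using B by simp
  finally have eq: "?A *\<^sub>v v = vec n x" .
  show thesis
  proof (rule that)
    fix i assume i: "i < n"
    have "(?A *\<^sub>v v) $ i = (\<Sum>j<n. M i j * v $ j)"
      using i v by (simp add: scalar_prod_def atLeast0LessThan)
    then show "(\<Sum>j<n. M i j * v $ j) = x i" using eq i by simp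
  qed
qed

lemma skew_quadratic_form:
  fixes M :: "nat \<Rightarrow> nat \<Rightarrow> rat"
  assumes skew: "\<And>i j. i < n \<Longrightarrow> j < n \<Longrightarrow> M i j = - M j i"
  shows "(\<Sum>i<n. u i * (\<Sum>j<n. M i j * v j)) = - (\<Sum>i<n. v i * (\<Sum>j<n. M i j * u j))"
proof -
  have "(\<Sum>i<n. u i * (\<Sum>j<n. M i j * v j)) = (\<Sum>i<n. \<Sum>j<n. u i * (M i j * v j))"
    by (simp add: sum_distrib_left)
  also have "\<dots> = (\<Sum>j<n. \<Sum>i<n. u i * (M i j * v j))" by (rule sum.swap)
  also have "\<dots> = (\<Sum>j<n. \<Sum>i<n. - (v j * (M j i * u i)))"
  proof (intro sum.cong refl)
    fix i j assume "i \<in> {..<n}" "j \<in> {..<n}"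
    then have "M i j = - M j i" using skew[of i j] by simp
    then show "u i * (M i j * v j) = - (v j * (M j i * u i))" by simp
  qed
  also have "\<dots> = - (\<Sum>j<n. v j * (\<Sum>i<n. M j i * u i))"
    by (simp add: sum_distrib_left sum_negf)
  finally show ?thesis .
qed

lemma skew_quadratic_form_zero:
  fixes M :: "nat \<Rightarrow> nat \<Rightarrow> rat"
  assumes skew: "\<And>i j. i < n \<Longrightarrow> j < n \<Longrightarrow> M i j = - M j i"
  shows "(\<Sum>i<n. u i * (\<Sum>j<n. M i j * u j)) = 0"
  using skew_quadratic_form[where M = M and n = n and u = u and v = u, OF skew] by simp

text \<open>Cramer's rule applied twice with the same \<open>u\<close>. Putting
  \<open>x = M u\<close> into column \<open>p\<close> gives a factor \<open>u p\<close>. For the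
  resulting matrix B, the transpose maps \<open>u\<close> to \<open>- x\<close> off
  \<open>p\<close>, by skewness, and to 0 at \<open>p\<close>, because the quadratic form of
  \<open>M\<close> vanishes; that vector is the wanted row, so a second factor \<open>u p\<close>
  appears.\<close>

lemma fdet_replace_skew:
  fixes M :: "nat \<Rightarrow> nat \<Rightarrow> rat"
  assumes skew: "\<And>i j. i < n \<Longrightarrow> j < n \<Longrightarrow> M i j = - M j i"
    and sol: "\<And>i. i < n \<Longrightarrow> (\<Sum>j<n. M i j * u j) = x i"
    and p: "p < n"
  shows "fdet n (\<lambda>i j. if i = p then if j = p then 0 else - x j
                       else if j = p then x i else M i j) = (u p)\<^sup>2 * fdet n M"
proof -
  let ?A = "mat n n (\<lambda>(i, j). M i j)"
  let ?B = "mat n n (\<lambda>(i, j). if j = p then x i else M i j)"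
  let ?C = "mat n n (\<lambda>(i, j). if i = p then if j = p then 0 else - x j
                       else if j = p then x i else M i j)"
  have A: "?A \<in> carrier_mat n n" and B: "?B \<in> carrier_mat n n" and C: "?C \<in> carrier_mat n n"
    and u: "vec n u \<in> carrier_vec n"
    by auto
  have Au: "?A *\<^sub>v vec n u = vec n x"
    by (rule eq_vecI) (use sol in \<open>auto simp: scalar_prod_def atLeast0LessThan\<close>)
  have "replace_col ?A (?A *\<^sub>v vec n u) p = ?B"
    unfolding Au by (rule eq_matI) (auto simp: replace_col_def)
  then have dB: "det ?B = u p * det ?A"
    using cramer_lemma_mat[OF A u p] p by simp
  have BT: "transpose_mat ?B \<in> carrier_mat n n" by simp
  have BTu: "(transpose_mat ?B *\<^sub>v vec n u) $ j = (if j = p then 0 else - x j)" if j: "j < n" for j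
  proof -
    have "(transpose_mat ?B *\<^sub>v vec n u) $ j = (\<Sum>i<n. (if j = p then x i else M i j) * u i)"
      using j by (simp add: scalar_prod_def atLeast0LessThan)
    also have "\<dots> = (if j = p then 0 else - x j)"
    proof (cases "j = p")
      case True
      have "(\<Sum>i<n. x i * u i) = (\<Sum>i<n. u i * (\<Sum>j<n. M i j * u j))"
        by (rule sum.cong) (use sol in auto)
      also have "\<dots> = 0" using skew by (rule skew_quadratic_form_zero)
      finally show ?thesis using True by simp
    next
      case False
      have "(\<Sum>i<n. M i j * u i) = (\<Sum>i<n. - (M j i * u i))"
      proof (rule sum.cong)
        fix i assume "i \<in> {..<n}"
        then have "M i j = - M j i" using skew[of i j] j by simp
        then show "M i j * u i = - (M j i * u i)" by simp
      qed simp
      also have "\<dots> = - x j" using sol[OF j] by (simp add: sum_negf)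
      finally show ?thesis using False by simp
    qed
    finally show ?thesis .
  qed
  have "replace_col (transpose_mat ?B) (transpose_mat ?B *\<^sub>v vec n u) p = transpose_mat ?C"
    unfolding replace_col_def by (rule eq_matI) (auto simp: BTu simp del: index_mult_mat_vec)
  then have "det (transpose_mat ?C) = u p * det (transpose_mat ?B)"
    using cramer_lemma_mat[OF BT u p] p by simp
  then show ?thesis
    using det_transpose[OF B] det_transpose[OF C] dB by (simp add: power2_eq_square)
qed

lemma fdet_2: "fdet 2 M = M 0 0 * M 1 1 - M 0 1 * M 1 0"
proof -
  have c: "mat 2 2 (\<lambda>(i, j). M i j) \<in> carrier_mat 2 2" by simp
  show ?thesis
    by (subst laplace_expansion_row[OF c, of 0])
      (auto simp: numeral_2_eq_2 cofactor_def mat_delete_def det_single)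
qed

text \<open>Column operations clear the upper right block and leave a Schur complement of size 2. It
  is again skew, so its determinant is the square of its off-diagonal entry.\<close>

lemma fdet_extend_skew:
  fixes M :: "nat \<Rightarrow> nat \<Rightarrow> rat"
  assumes skew: "\<And>i j. i < n + 2 \<Longrightarrow> j < n + 2 \<Longrightarrow> M i j = - M j i"
    and nz: "fdet n M \<noteq> 0"
    and sol: "\<And>i. i < n \<Longrightarrow> (\<Sum>j<n. M i j * u j) = M i (n + 1)"
  shows "fdet (n + 2) M = fdet n M * (M n (n + 1) + (\<Sum>i<n. M i n * u i))\<^sup>2"
proof -
  obtain v where v: "\<And>i. i < n \<Longrightarrow> (\<Sum>j<n. M i j * v j) = M i n"
    using fdet_solution[OF nz, of "\<lambda>i. M i n"] by blast
  \<comment> \<open>The columns of \<open>U\<close> solve the systems for the last two columns of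
    \<open>M\<close>; subtracting these combinations of the first n columns clears the
    block.\<close>
  define U where "U = (\<lambda>j. \<lambda>c::nat. if c = 0 then v j else u j)"
  have U: "(\<Sum>j<n. M i j * U j c) = M i (n + c)" if "i < n" "c < 2" for i c
    using that sol v by (cases c) (auto simp: U_def)
  let ?S = "mat n n (\<lambda>(i, j). M i j)"
  let ?B = "mat n 2 (\<lambda>(i, c). M i (n + c))"
  let ?C = "mat 2 n (\<lambda>(c, j). M (n + c) j)"
  let ?D = "mat 2 2 (\<lambda>(c, d). M (n + c) (n + d))"
  let ?U = "mat n 2 (\<lambda>(j, c). - U j c)"
  let ?M = "mat (n + 2) (n + 2) (\<lambda>(i, j). M i j)"
  let ?Q = "four_block_mat (1\<^sub>m n) ?U (0\<^sub>m 2 n) (1\<^sub>m 2)"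
  let ?E = "mat 2 2 (\<lambda>(c, d). M (n + c) (n + d) - (\<Sum>j<n. M (n + c) j * U j d))"
  have M: "?M = four_block_mat ?S ?B ?C ?D"
    by (rule eq_matI) (auto simp: four_block_mat_def)
  have "?M * ?Q = four_block_mat (?S * 1\<^sub>m n + ?B * 0\<^sub>m 2 n) (?S * ?U + ?B * 1\<^sub>m 2)
      (?C * 1\<^sub>m n + ?D * 0\<^sub>m 2 n) (?C * ?U + ?D * 1\<^sub>m 2)"
    unfolding M by (rule mult_four_block_mat) auto
  also have "?S * 1\<^sub>m n + ?B * 0\<^sub>m 2 n = ?S" by simp
  also have "?C * 1\<^sub>m n + ?D * 0\<^sub>m 2 n = ?C" by simp
  also have "?S * ?U + ?B * 1\<^sub>m 2 = 0\<^sub>m n 2"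
    by (rule eq_matI) (auto simp: scalar_prod_def atLeast0LessThan sum_negf U)
  also have "?C * ?U + ?D * 1\<^sub>m 2 = ?E"
    by (rule eq_matI) (auto simp: scalar_prod_def atLeast0LessThan sum_negf)
  finally have MQ: "?M * ?Q = four_block_mat ?S (0\<^sub>m n 2) ?C ?E" .
  have "det ?M * det ?Q = det (?M * ?Q)"
    by (rule det_mult[symmetric]) auto
  also have "\<dots> = det ?S * det ?E"
    unfolding MQ by (rule det_four_block_mat_upper_right_zero) auto
  finally have det1: "det ?M * det ?Q = det ?S * det ?E" .
  have "det ?Q = det (1\<^sub>m n) * det (1\<^sub>m 2 :: rat mat)"
    by (rule det_four_block_mat_lower_left_zero) auto
  then have det2: "det ?Q = 1" by simp
  let ?d = "M n (n + 1) + (\<Sum>i<n. M i n * u i)"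
  have S0: "(\<Sum>j<n. M n j * w j) = - (\<Sum>j<n. M j n * w j)" for w
    unfolding sum_negf[symmetric] by (rule sum.cong[OF refl]) (subst skew[of n], auto)
  have S1: "(\<Sum>j<n. M (n + 1) j * w j) = - (\<Sum>j<n. M j (n + 1) * w j)" for w
    unfolding sum_negf[symmetric] by (rule sum.cong[OF refl]) (subst skew[of "n + 1"], auto)
  have vn: "(\<Sum>j<n. M j n * w j) = (\<Sum>i<n. w i * (\<Sum>j<n. M i j * v j))" for w
    by (rule sum.cong) (use v in auto)
  have un: "(\<Sum>j<n. M j (n + 1) * w j) = (\<Sum>i<n. w i * (\<Sum>j<n. M i j * u j))" for w
    by (rule sum.cong) (use sol in auto)
  have sk: "\<And>i j. i < n \<Longrightarrow> j < n \<Longrightarrow> M i j = - M j i" by (rule skew) simp_all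
  have z: "(\<Sum>j<n. M j n * v j) = 0" "(\<Sum>j<n. M j (n + 1) * u j) = 0"
    unfolding vn un by (rule skew_quadratic_form_zero, rule sk, assumption+)+
  have uv: "(\<Sum>j<n. M j (n + 1) * v j) = - (\<Sum>j<n. M j n * u j)"
    unfolding vn un using sk by (rule skew_quadratic_form)
  have d0: "M n n = 0" "M (n + 1) (n + 1) = 0" "M (n + 1) n = - M n (n + 1)"
    using skew[of n n] skew[of "n + 1" "n + 1"] skew[of "n + 1" n] by auto
  have "det ?E = ?d\<^sup>2"
    unfolding fdet_2 U_def using S0[of v] S0[of u] S1[of v] S1[of u] z uv d0
    by (simp add: power2_eq_square algebra_simps)
  then show ?thesis using det1 det2 by simp
qed

text \<open>The vertices n and n + 1 are copies of \<open>p\<close> and \<open>q\<close>;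
  \<open>a\<close> and \<open>b\<close> are the entries between an original and its copy, and
  \<open>s\<close> is column \<open>q\<close> of the inverse.\<close>

lemma fdet_extend_twins:
  fixes M :: "nat \<Rightarrow> nat \<Rightarrow> rat"
  assumes skew: "\<And>i j. i < n + 2 \<Longrightarrow> j < n + 2 \<Longrightarrow> M i j = - M j i"
    and nz: "fdet n M \<noteq> 0"
    and p: "p < n" and q: "q < n"
    and X: "\<And>i. i < n \<Longrightarrow> M i n = M i p + a * of_bool (i = p)"
    and Y: "\<And>i. i < n \<Longrightarrow> M i (n + 1) = M i q + b * of_bool (i = q)"
    and s: "\<And>i. i < n \<Longrightarrow> (\<Sum>j<n. M i j * s j) = of_bool (i = q)"
  shows "fdet (n + 2) M =
    fdet n M * (M n (n + 1) - M p q + (a - b) * of_bool (p = q) + a * b * s p)\<^sup>2"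
proof -
  \<comment> \<open>Column n + 1 is \<open>M\<close> applied to the unit vector at \<open>q\<close>,
    plus \<open>b\<close> times that unit vector; applying the inverse gives the unit vector plus
    \<open>b * s\<close>.\<close>
  define u where "u = (\<lambda>j. of_bool (j = q) + b * s j)"
  have "(\<Sum>j<n. M i j * u j) = M i (n + 1)" if i: "i < n" for i
  proof -
    have "(\<Sum>j<n. M i j * u j) = (\<Sum>j<n. M i j * of_bool (j = q)) + b * (\<Sum>j<n. M i j * s j)"
      by (simp add: u_def distrib_left sum.distrib sum_distrib_left mult.left_commute)
    also have "(\<Sum>j<n. M i j * of_bool (j = q)) = M i q"
      using q by (simp add: of_bool_def if_distrib cong: if_cong)
    finally show ?thesis using Y[OF i] s[OF i] by simp
  qed
  then have main: "fdet (n + 2) M = fdet n M * (M n (n + 1) + (\<Sum>i<n. M i n * u i))\<^sup>2"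
    using skew nz by (intro fdet_extend_skew)
  have "(\<Sum>i<n. M i n * u i) = (\<Sum>i<n. M i p * u i) + a * (\<Sum>i<n. of_bool (i = p) * u i)"
    unfolding sum_distrib_left sum.distrib[symmetric]
    by (rule sum.cong) (use X in \<open>auto simp: distrib_right\<close>)
  also have "(\<Sum>i<n. of_bool (i = p) * u i) = u p"
    using p by (simp add: of_bool_def if_distrib if_distribR cong: if_cong)
  also have "(\<Sum>i<n. M i p * u i) = - (\<Sum>i<n. M p i * u i)"
    unfolding sum_negf[symmetric] by (rule sum.cong[OF refl]) (subst skew[of _ p], use p in auto)
  also have "(\<Sum>i<n. M p i * u i) = (\<Sum>i<n. M p i * of_bool (i = q)) + b * (\<Sum>j<n. M p j * s j)"
    by (simp add: u_def distrib_left sum.distrib sum_distrib_left mult.left_commute)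
  also have "\<dots> = M p q + b * of_bool (p = q)"
    using s[OF p] q by (simp add: of_bool_def if_distrib cong: if_cong)
  finally have "M n (n + 1) + (\<Sum>i<n. M i n * u i)
      = M n (n + 1) - M p q + (a - b) * of_bool (p = q) + a * b * s p"
    by (simp add: u_def algebra_simps)
  with main show ?thesis by (simp only:)
qed

section \<open>The switched tournament \<open>L\<close>\<close>

text \<open>The signs of \<open>L (m + 1)\<close> for odd \<open>m\<close>, with the vertex \<open>m + 1\<close> renamed to \<open>0\<close>, after switching the
  even vertices among \<open>1..m\<close>. Unlike \<open>L (m + 1)\<close>, this does not depend on \<open>m\<close>, and rotating
  \<open>1..m\<close> cyclically is an automorphism.\<close>

definition core :: "nat \<Rightarrow> nat \<Rightarrow> rat" where
  "core i j = (if i = j then 0 else if i = 0 then 1 else if j = 0 then -1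
               else if i < j then (-1) ^ (i + j) else - ((-1) ^ (i + j)))"

definition cyc :: "nat \<Rightarrow> nat \<Rightarrow> nat" where
  "cyc m i = (if i = m then 1 else i + 1)"

lemma core_skew: "core i j = - core j i"
  by (auto simp: core_def add.commute)

lemma core_diag [simp]: "core i i = 0"
  by (simp add: core_def)

text \<open>Moving to the next row changes the sign (-1)^(i + j), so the two rows cancel wherever
  \<open>j\<close> is on the same side of both. Oddness of \<open>m\<close> produces the same
  cancellation at the wrap from \<open>m\<close> to 1.\<close>

lemma core_row_sum:
  assumes "odd m" "1 \<le> i" "i \<le> m" "1 \<le> j" "j \<le> m"
  shows "core i j + core (cyc m i) j = of_bool (j = i) - of_bool (j = cyc m i)"
  using assms by (auto simp: core_def cyc_def minus_one_power_iff)

lemma cyc_range: "1 \<le> i \<Longrightarrow> i \<le> m \<Longrightarrow> 1 \<le> cyc m i \<and> cyc m i \<le> m"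
  by (auto simp: cyc_def)

lemma sum_cyc: "(\<Sum>i=1..m. f (cyc m i)) = (\<Sum>i=1..m. f i)"
proof (cases m)
  case (Suc n)
  have "(\<Sum>i=1..Suc n. f (cyc m i)) = (\<Sum>i=1..n. f (cyc m i)) + f (cyc m (Suc n))"
    by simp
  also have "(\<Sum>i=1..n. f (cyc m i)) = (\<Sum>i=1..n. f (Suc i))"
    by (rule sum.cong) (auto simp: cyc_def Suc)
  also have "\<dots> = (\<Sum>i=Suc 1..Suc n. f i)"
    by (rule sum.shift_bounds_cl_Suc_ivl[symmetric])
  also have "f (cyc m (Suc n)) = f 1" by (simp add: cyc_def Suc)
  also have "(\<Sum>i=Suc 1..Suc n. f i) + f 1 = (\<Sum>i=1..Suc n. f i)"
    by (subst (2) sum.atLeast_Suc_atMost) (auto simp: add.commute)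
  finally show ?thesis by (simp add: Suc)
qed simp

lemma sum_lessThan_Suc_zero:
  "(\<Sum>j<Suc m. f j) = f 0 + (\<Sum>j=1..m. f j :: rat)"
proof -
  have "{..<Suc m} = insert 0 {1..m}" by auto
  then show ?thesis by simp
qed

section \<open>Linear systems with matrix \<open>core\<close>, its inverse and its
  determinant\<close>

context
  fixes m :: nat and u x :: "nat \<Rightarrow> rat"
  assumes m: "odd m"
    and sys: "\<And>i. i \<le> m \<Longrightarrow> (\<Sum>j<Suc m. core i j * u j) = x i"
begin

lemma core_system_total: "(\<Sum>j=1..m. u j) = x 0"
proof -
  have "(\<Sum>j=1..m. core 0 j * u j) = (\<Sum>j=1..m. u j)"
    by (rule sum.cong) (auto simp: core_def)
  then show ?thesis using sys[of 0] by (simp only: sum_lessThan_Suc_zero) simp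
qed

text \<open>In the sum of the two equations only the columns \<open>i\<close>,
  \<open>cyc m i\<close> and 0 survive, the last one with coefficient -2. The system becomes a
  recursion around the cycle.\<close>

lemma core_system_step:
  assumes i: "1 \<le> i" "i \<le> m"
  shows "u (cyc m i) = u i - 2 * u 0 - (x i + x (cyc m i))"
proof -
  let ?c = "cyc m i"
  have c: "1 \<le> ?c" "?c \<le> m" using cyc_range[OF i] by auto
  have "x i + x ?c = (\<Sum>j<Suc m. core i j * u j) + (\<Sum>j<Suc m. core ?c j * u j)"
    using sys[of i] sys[of ?c] i c by simp
  also have "\<dots> = (\<Sum>j<Suc m. (core i j + core ?c j) * u j)"
    by (simp only: distrib_right sum.distrib)
  also have "\<dots> = -2 * u 0 + (\<Sum>j=1..m. (core i j + core ?c j) * u j)"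
    unfolding sum_lessThan_Suc_zero using i c by (simp add: core_def)
  also have "(\<Sum>j=1..m. (core i j + core ?c j) * u j)
      = (\<Sum>j=1..m. of_bool (j = i) * u j - of_bool (j = ?c) * u j)"
    by (rule sum.cong) (use core_row_sum[OF m i] in \<open>auto simp: left_diff_distrib\<close>)
  also have "\<dots> = (\<Sum>j\<in>{1..m}. if j = i then u j else 0) - (\<Sum>j\<in>{1..m}. if j = ?c then u j else 0)"
    unfolding sum_subtractf by (intro arg_cong2[of _ _ _ _ "(-)"] sum.cong) auto
  also have "\<dots> = u i - u ?c" using i c by simp
  finally show ?thesis by simp
qed

text \<open>The recursion telescopes when summed once around the cycle, which determines
  \<open>u 0\<close>.\<close>

lemma core_system_apex: "of_nat m * u 0 = - (\<Sum>i=1..m. x i)"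
proof -
  have "(\<Sum>i=1..m. u (cyc m i)) = (\<Sum>i=1..m. u i - 2 * u 0 - (x i + x (cyc m i)))"
    by (rule sum.cong) (auto simp: core_system_step)
  then have "(\<Sum>i=1..m. u i) = (\<Sum>i=1..m. u i) - of_nat m * (2 * u 0) - 2 * (\<Sum>i=1..m. x i)"
    unfolding sum_subtractf sum.distrib sum_cyc[of u] sum_cyc[of x] by simp
  then show ?thesis by simp
qed

end

text \<open>Column \<open>p\<close> of the inverse. Away from \<open>p\<close> the recursion has
  constant increment 2 / m; the starting value \<open>u p = 0\<close> comes from skewness.\<close>

lemma core_inverse_entries:
  assumes m: "odd m"
    and sys: "\<And>i. i \<le> m \<Longrightarrow> (\<Sum>j<Suc m. core i j * u j) = of_bool (i = p)"
    and p: "1 \<le> p" "p \<le> m"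
  shows "u 0 = - 1 / of_nat m"
    and "u p = 0"
    and "p < q \<Longrightarrow> q \<le> m \<Longrightarrow> u q = 2 * of_nat (q - p) / of_nat m - 1"
    and "1 \<le> q \<Longrightarrow> q < p \<Longrightarrow> u q = 1 - 2 * of_nat (p - q) / of_nat m"
proof -
  have m0: "of_nat m \<noteq> (0 :: rat)" using m by (auto intro!: Nat.gr0I)
  have "of_nat m * u 0 = - (\<Sum>i=1..m. of_bool (i = p))"
    using core_system_apex[OF m sys] by simp
  also have "(\<Sum>i=1..m. of_bool (i = p)) = (1 :: rat)"
    using p by (simp add: of_bool_def)
  finally show u0: "u 0 = - 1 / of_nat m" using m0 by (simp add: field_simps)
  \<comment> \<open>Both sides are the quadratic form of \<open>core\<close> at \<open>u\<close>;
    evaluated through the system it is just \<open>u p\<close>.\<close>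
  have "(\<Sum>i<Suc m. u i * of_bool (i = p)) = (\<Sum>i<Suc m. u i * (\<Sum>j<Suc m. core i j * u j))"
    by (rule sum.cong) (use sys in auto)
  also have "\<dots> = 0" by (rule skew_quadratic_form_zero) (rule core_skew)
  also have "(\<Sum>i<Suc m. u i * of_bool (i = p)) = u p"
    using p by (simp add: of_bool_def if_distrib cong: if_cong del: sum.lessThan_Suc)
  finally show up: "u p = 0" .
  have step: "u (Suc i) = u i + 2 / of_nat m - of_bool (i = p) - of_bool (Suc i = p)"
    if "1 \<le> i" "i < m" for i
    using core_system_step[OF m sys, of i] that u0 by (simp add: cyc_def)
  have up_eq: "p + Suc d \<le> m \<Longrightarrow> u (p + Suc d) = 2 * of_nat (Suc d) / of_nat m - 1" for d
  proof (induction d)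
    case 0
    then show ?case using step[of p] p up by simp
  next
    case (Suc d)
    have "u (Suc (p + Suc d)) = u (p + Suc d) + 2 / of_nat m"
      using step[of "p + Suc d"] Suc.prems p by simp
    then show ?case using Suc m0 by (simp add: add_divide_distrib algebra_simps)
  qed
  then show "p < q \<Longrightarrow> q \<le> m \<Longrightarrow> u q = 2 * of_nat (q - p) / of_nat m - 1"
    using up_eq[of "q - p - 1"] by simp
  have down_eq: "1 + Suc d \<le> p \<Longrightarrow> u (p - Suc d) = 1 - 2 * of_nat (Suc d) / of_nat m" for d
  proof (induction d)
    case 0
    then have "Suc (p - 1) = p" "1 \<le> p - 1" "p - 1 < m" "p - 1 \<noteq> p" using p by auto
    then show ?case using step[of "p - 1"] up by simp
  next
    case (Suc d)
    have "Suc (p - Suc (Suc d)) = p - Suc d" "p - Suc d \<noteq> p" "p - Suc (Suc d) \<noteq> p"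
      using Suc.prems by auto
    then have "u (p - Suc d) = u (p - Suc (Suc d)) + 2 / of_nat m"
      using step[of "p - Suc (Suc d)"] Suc.prems p by simp
    then show ?case using Suc m0 by (simp add: add_divide_distrib algebra_simps)
  qed
  then show "1 \<le> q \<Longrightarrow> q < p \<Longrightarrow> u q = 1 - 2 * of_nat (p - q) / of_nat m"
    using down_eq[of "p - q - 1"] by simp
qed

text \<open>Strictness is the point: in \<open>twin_pair\<close> such an entry has to be too small
  to compensate for a wrong arc. For \<open>p = 0\<close> the column is constant 1 / m on the cycle
  and 0 at the apex.\<close>

lemma core_inverse_small:
  assumes m: "odd m" "3 \<le> m"
    and sys: "\<And>i. i \<le> m \<Longrightarrow> (\<Sum>j<Suc m. core i j * u j) = of_bool (i = p)"
    and p: "p \<le> m" and q: "q \<le> m"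
  shows "\<bar>u q\<bar> < 1"
proof (cases "p = 0")
  case True
  have m0: "of_nat m > (0 :: rat)" using m by simp
  have "(\<Sum>i=1..m. of_bool (i = p)) = (0 :: rat)" using True by simp
  then have u0: "u 0 = 0" using core_system_apex[OF m(1) sys] m0 by simp
  have eq: "1 \<le> i \<Longrightarrow> i \<le> m \<Longrightarrow> u i = u 1" for i
  proof (induction i rule: dec_induct)
    case (step n)
    have "u (cyc m n) = u n - 2 * u 0 - (of_bool (n = p) + of_bool (cyc m n = p))"
      using step by (intro core_system_step[OF m(1) sys]) auto
    then show ?case using step True u0 by (simp add: cyc_def)
  qed simp
  have "(\<Sum>j=1..m. u j) = (\<Sum>j=1..m. u 1)" by (rule sum.cong[OF refl], rule eq) auto
  then have "of_nat m * u 1 = 1" using core_system_total[OF m(1) sys] True by simp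
  then have "u 1 = 1 / of_nat m" using m0 by (simp add: field_simps)
  moreover have "1 / of_nat m < (1 :: rat)" using m by simp
  moreover have "u q = 0 \<or> u q = u 1" using eq[of q] q u0 by (cases "q = 0") simp_all
  ultimately show ?thesis using m0 by (elim disjE) simp_all
next
  case False
  then have p1: "1 \<le> p" by simp
  note E = core_inverse_entries[OF m(1) sys p1 p]
  consider "q = 0" | "q = p" | "p < q" | "1 \<le> q" "q < p" by linarith
  then show ?thesis
  proof cases
    case 1
    have "1 / of_nat m < (1 :: rat)" using m(2) by simp
    then show ?thesis using E(1) 1 by simp
  next
    case 2 then show ?thesis using E(2) by simp
  next
    case 3
    have "0 < of_nat (q - p) / (of_nat m :: rat)" "of_nat (q - p) / (of_nat m :: rat) < 1"
      using 3 q p1 by (auto simp: field_simps simp del: of_nat_diff)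
    moreover have "u q = 2 * of_nat (q - p) / of_nat m - 1" by (rule E(3)) (use 3 q in auto)
    ultimately show ?thesis unfolding abs_less_iff times_divide_eq_right[symmetric] by linarith
  next
    case 4
    have "0 < of_nat (p - q) / (of_nat m :: rat)" "of_nat (p - q) / (of_nat m :: rat) < 1"
      using 4 p by (auto simp: field_simps simp del: of_nat_diff)
    moreover have "u q = 1 - 2 * of_nat (p - q) / of_nat m" by (rule E(4)) (use 4 in auto)
    ultimately show ?thesis unfolding abs_less_iff times_divide_eq_right[symmetric] by linarith
  qed
qed

text \<open>Passing from \<open>l\<close> to \<open>l + 2\<close> adds two twins, so
  \<open>fdet_extend_twins\<close> gives the factor (1 + 2 / l)^2, which turns l^2 into (l +
  2)^2.\<close>

lemma fdet_core: "odd m \<Longrightarrow> fdet (Suc m) core = (of_nat m)\<^sup>2"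
proof (induction m rule: less_induct)
  case (less m)
  show ?case
  proof (cases "m = 1")
    case True
    then show ?thesis using fdet_2[of core] by (simp add: core_def numeral_2_eq_2)
  next
    case False
    define l where "l = m - 2"
    have l: "odd l" "1 \<le> l" "m = l + 2" using False less.prems by (auto simp: l_def elim!: oddE)
    have IH: "fdet (Suc l) core = (of_nat l)\<^sup>2" using less.IH[of l] l by simp
    have l0: "of_nat l \<noteq> (0 :: rat)" using l by simp
    have nz: "fdet (Suc l) core \<noteq> 0" using IH l0 by simp
    obtain s where s: "\<And>i. i < Suc l \<Longrightarrow> (\<Sum>j<Suc l. core i j * s j) = of_bool (i = l)"
      using fdet_solution[OF nz, of "\<lambda>i. of_bool (i = l)"] by blast
    have s': "\<And>i. i \<le> l \<Longrightarrow> (\<Sum>j<Suc l. core i j * s j) = of_bool (i = l)"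
      by (rule s) simp
    \<comment> \<open>Vertex \<open>l + 1\<close> is a twin of 1, being next to it on the longer
      cycle up to sign changes already absorbed in \<open>core\<close>, and \<open>l + 2\<close> is
      a twin of \<open>l\<close>.\<close>
    have X: "core i (Suc l) = core i 1 + (-1) * of_bool (i = 1)" if "i < Suc l" for i
      using that l by (auto simp: core_def minus_one_power_iff)
    have Y: "core i (Suc l + 1) = core i l + 1 * of_bool (i = l)" if "i < Suc l" for i
      using that l by (auto simp: core_def minus_one_power_iff)
    have "fdet (Suc l + 2) core = fdet (Suc l) core *
        (core (Suc l) (Suc l + 1) - core 1 l + (-1 - 1) * of_bool (1 = l) + (-1) * 1 * s 1)\<^sup>2"
      by (rule fdet_extend_twins[OF core_skew nz _ _ X Y s]) (use l in auto)
    also have "core (Suc l) (Suc l + 1) - core 1 l + (-1 - 1) * of_bool (1 = l) + (-1) * 1 * s 1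
        = - (1 + 2 / of_nat l)"
    \<comment> \<open>For \<open>l = 1\<close> both new vertices are twins of the same vertex: the
      term with \<open>of_bool\<close> is present and \<open>s 1\<close> is a diagonal entry of the
      inverse, hence 0.\<close>
    proof (cases "l = 1")
      case True
      then show ?thesis using core_inverse_entries(2)[OF l(1) s'] by (simp add: core_def)
    next
      case False
      have "s 1 = 1 - 2 * of_nat (l - 1) / of_nat l"
        using False l by (intro core_inverse_entries(4)[OF l(1) s']) auto
      also have "\<dots> = 2 / of_nat l - 1" using l(2) l0 by (simp add: of_nat_diff field_simps)
      finally have "s 1 = 2 / of_nat l - 1" .
      moreover have "core (Suc l) (Suc l + 1) = -1" "core 1 l = 1"
        using False l by (auto simp: core_def minus_one_power_iff)
      ultimately show ?thesis using False by simp
    qed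
    also have "fdet (Suc l) core * (- (1 + 2 / of_nat l))\<^sup>2 = (of_nat l * (1 + 2 / of_nat l))\<^sup>2"
      unfolding IH by (simp only: power_mult_distrib power2_minus)
    also have "of_nat l * (1 + 2 / of_nat l) = (of_nat m :: rat)"
      using l0 l by (simp add: field_simps)
    finally show ?thesis using l by simp
  qed
qed

section \<open>Sign patterns of a further vertex\<close>

text \<open>The apex 0 is fixed; rotating brings a chosen adjacent pair of the cycle to the
  positions \<open>k - 1\<close> and \<open>k\<close>.\<close>

definition rot :: "nat \<Rightarrow> nat \<Rightarrow> nat \<Rightarrow> nat" where
  "rot k t = ((\<lambda>i. if i = 0 then 0 else cyc k i) ^^ t)"

lemma rot_0 [simp]: "rot k 0 i = i"
  by (simp add: rot_def)

lemma rot_Suc: "rot k (Suc t) i = (if rot k t i = 0 then 0 else cyc k (rot k t i))"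
  by (simp add: rot_def)

lemma rot_zero [simp]: "rot k t 0 = 0"
  by (induction t) (simp_all add: rot_Suc)

lemma rot_range: "1 \<le> i \<Longrightarrow> i \<le> k \<Longrightarrow> 1 \<le> rot k t i \<and> rot k t i \<le> k"
  by (induction t) (use cyc_range in \<open>auto simp: rot_Suc\<close>)

lemma rot_le: "i \<le> k \<Longrightarrow> rot k t i \<le> k"
  using rot_range[of i k t] by (cases "i = 0") auto

lemma rot_cyc:
  assumes "1 \<le> i" "i \<le> k"
  shows "rot k t (cyc k i) = cyc k (rot k t i)"
proof (induction t)
  case (Suc t)
  have "rot k t (cyc k i) \<noteq> 0" "rot k t i \<noteq> 0"
    using rot_range[of "cyc k i" k t] rot_range[of i k t] cyc_range[of i k] assms by auto
  then show ?case using Suc by (simp add: rot_Suc)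
qed simp

lemma cyc_inj: "1 \<le> i \<Longrightarrow> i \<le> k \<Longrightarrow> 1 \<le> j \<Longrightarrow> j \<le> k \<Longrightarrow> cyc k i = cyc k j \<longleftrightarrow> i = j"
  by (auto simp: cyc_def)

lemma rot_inj: "inj_on (rot k t) {..k}"
proof (induction t)
  case 0
  then show ?case by (simp add: inj_on_def)
next
  case (Suc t)
  show ?case
  proof (rule inj_onI)
    fix i j assume ij: "i \<in> {..k}" "j \<in> {..k}" "rot k (Suc t) i = rot k (Suc t) j"
    have le: "rot k t i \<le> k" "rot k t j \<le> k" using ij rot_le by auto
    have "rot k t i = rot k t j"
      using ij(3) le cyc_inj[of "rot k t i" k "rot k t j"]
        cyc_range[of "rot k t i" k] cyc_range[of "rot k t j" k]
      by (auto simp: rot_Suc split: if_splits)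
    then show "i = j" using Suc ij by (auto dest: inj_onD)
  qed
qed

lemma rot_image: "rot k t ` {..k} = {..k}"
  by (rule card_subset_eq) (auto simp: rot_le card_image[OF rot_inj])

text \<open>The first step leads from \<open>k\<close> to 1, so the number of steps equals the
  target.\<close>

lemma rot_reaches:
  assumes "1 \<le> p" "p \<le> k"
  shows "rot k p k = p"
  using assms
proof (induction p)
  case (Suc p)
  then show ?case by (cases "p = 0") (auto simp: rot_Suc cyc_def)
qed simp

lemma sum_rot: "(\<Sum>i=1..k. f (rot k t i)) = (\<Sum>i=1..k. f i)"
proof (induction t)
  case (Suc t)
  have "(\<Sum>i=1..k. f (rot k (Suc t) i)) = (\<Sum>i=1..k. f (rot k t (cyc k i)))"
  proof (rule sum.cong)
    fix i assume "i \<in> {1..k}"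
    then show "f (rot k (Suc t) i) = f (rot k t (cyc k i))"
      using rot_range[of i k t] by (simp add: rot_Suc rot_cyc)
  qed simp
  then show ?case using Suc sum_cyc[of "\<lambda>i. f (rot k t i)" k] by simp
qed simp

lemma core_cyc:
  assumes "odd k" "1 \<le> i" "i \<le> k" "1 \<le> j" "j \<le> k"
  shows "core (cyc k i) (cyc k j) = core i j"
  using assms by (auto simp: core_def cyc_def minus_one_power_iff)

lemma core_rot:
  assumes "odd k" "i \<le> k" "j \<le> k"
  shows "core (rot k t i) (rot k t j) = core i j"
proof (induction t)
  case (Suc t)
  have le: "rot k t i \<le> k" "rot k t j \<le> k" using assms rot_le by auto
  have c: "1 \<le> l \<Longrightarrow> l \<le> k \<Longrightarrow> cyc k l \<noteq> 0" for l by (simp add: cyc_def)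
  have "core (rot k (Suc t) i) (rot k (Suc t) j) = core (rot k t i) (rot k t j)"
    using le core_cyc[OF assms(1), of "rot k t i" "rot k t j"] c[of "rot k t i"] c[of "rot k t j"]
    by (cases "rot k t i = 0"; cases "rot k t j = 0") (simp_all add: rot_Suc core_def)
  then show ?case using Suc by simp
qed simp

text \<open>For a vertex \<open>x\<close> joined to the vertices \<open>1..m\<close> of \<open>core\<close> with signs \<open>z\<close>, the values
  \<open>W i\<close> are, up to sign, the Pfaffians obtained by replacing vertex \<open>i\<close> by \<open>x\<close>.\<close>

definition potential :: "nat \<Rightarrow> nat \<Rightarrow> (nat \<Rightarrow> rat) \<Rightarrow> bool" where
  "potential m b z \<longleftrightarrow> (\<exists>W. \<forall>i. 1 \<le> i \<and> i \<le> m \<longrightarrow> \<bar>W i\<bar> \<le> of_nat b \<and>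
     W (cyc m i) = W i + 2 * (\<Sum>j=1..m. z j) - of_nat m * (z i + z (cyc m i)))"

lemma potential_uminus:
  assumes "potential m b z"
  shows "potential m b (\<lambda>i. - z i)"
proof -
  obtain W where "\<forall>i. 1 \<le> i \<and> i \<le> m \<longrightarrow> \<bar>W i\<bar> \<le> of_nat b \<and>
     W (cyc m i) = W i + 2 * (\<Sum>j=1..m. z j) - of_nat m * (z i + z (cyc m i))"
    using assms by (auto simp: potential_def)
  then have "\<forall>i. 1 \<le> i \<and> i \<le> m \<longrightarrow> \<bar>- W i\<bar> \<le> of_nat b \<and>
     - W (cyc m i) = - W i + 2 * (\<Sum>j=1..m. - z j) - of_nat m * (- z i + - z (cyc m i))"
    by (simp add: sum_negf algebra_simps)
  then show ?thesis unfolding potential_def by (intro exI[of _ "\<lambda>i. - W i"])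
qed

lemma sum_signs:
  fixes z :: "nat \<Rightarrow> rat"
  assumes "\<And>i. 1 \<le> i \<Longrightarrow> i \<le> k \<Longrightarrow> z i = 1 \<or> z i = -1"
  shows "(\<Sum>i=1..k. z i) = of_nat k - 2 * of_nat (card {i \<in> {1..k}. z i = -1})"
proof -
  have "(\<Sum>i=1..k. z i) = (\<Sum>i=1..k. 1 - 2 * of_bool (z i = -1))"
    by (rule sum.cong) (use assms in auto)
  then show ?thesis
    by (simp add: sum_subtractf sum_distrib_left[symmetric] Int_def conj_commute)
qed

text \<open>An adjacent pair of minus signs makes the potential jump by more than \<open>2 * k\<close>; a minus sign
  and a run of three plus signs cannot both occur. Once these are excluded, turning an adjacent pair
  of plus signs into a pair of minus signs, by deleting it, makes the potential for
  \<open>k - 2\<close> rise too much, unless the sum of the signs is \<open>1\<close>.\<close>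

lemma sign_pattern_pos:
  fixes z :: "nat \<Rightarrow> rat"
  assumes k: "odd k" "5 \<le> k"
    and unit: "\<And>i. 1 \<le> i \<Longrightarrow> i \<le> k \<Longrightarrow> z i = 1 \<or> z i = -1"
    and pos: "(\<Sum>i=1..k. z i) > 0"
    and pot: "potential k k z"
    and pot': "\<And>t. potential (k - 2) k (\<lambda>i. z (rot k t i))"
  shows "(\<forall>i. 1 \<le> i \<and> i \<le> k \<longrightarrow> z i = 1) \<or>
    (\<exists>t. \<forall>i. 1 \<le> i \<and> i \<le> k \<longrightarrow> z (rot k t i) = (-1) ^ (i + 1))"
proof (subst disj_imp, rule impI)
  assume "\<not> (\<forall>i. 1 \<le> i \<and> i \<le> k \<longrightarrow> z i = 1)"
  then obtain n where n: "1 \<le> n" "n \<le> k" "z n = -1" using unit by auto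
  define K where "K = (\<Sum>i=1..k. z i)"
  define q where "q = card {i \<in> {1..k}. z i = -1}"
  have Kq: "K = of_nat k - 2 * of_nat q"
    unfolding K_def q_def using unit by (rule sum_signs)
  obtain W where W: "\<And>i. 1 \<le> i \<Longrightarrow> i \<le> k \<Longrightarrow> \<bar>W i\<bar> \<le> of_nat k"
    and step: "\<And>i. 1 \<le> i \<Longrightarrow> i \<le> k \<Longrightarrow> W (cyc k i) = W i + 2 * K - of_nat k * (z i + z (cyc k i))"
    using pot unfolding potential_def K_def by blast
  have nmm: "z (cyc k i) = 1" if i: "1 \<le> i" "i \<le> k" "z i = -1" for i
  proof (rule ccontr)
    have c: "1 \<le> cyc k i" "cyc k i \<le> k" using cyc_range i by auto
    assume "z (cyc k i) \<noteq> 1"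
    then have "z (cyc k i) = -1" using unit[OF c] by simp
    then have "W (cyc k i) - W i = 2 * K + 2 * of_nat k" using step[OF i(1,2)] i(3) by simp
    then show False using W[OF i(1,2)] W[OF c] pos unfolding K_def[symmetric] by linarith
  qed
  \<comment> \<open>Both neighbours of the minus sign at \<open>n\<close> are plus signs, so the two
    steps through \<open>n\<close> rise by 4 K in total, and the range has width 2 k.\<close>
  have K_small: "2 * K \<le> of_nat k"
  proof -
    define i where "i = (if n = 1 then k else n - 1)"
    have i: "1 \<le> i" "i \<le> k" "cyc k i = n" using n k by (auto simp: i_def cyc_def)
    have c: "1 \<le> cyc k n" "cyc k n \<le> k" using cyc_range n by auto
    have "z i = 1" using nmm[OF i(1,2)] unit[OF i(1,2)] i(3) n(3) by auto
    then have "W n = W i + 2 * K" using step[OF i(1,2)] i(3) n(3) by simp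
    moreover have "W (cyc k n) = W n + 2 * K" using step[OF n(1,2)] nmm[OF n] n(3) by simp
    ultimately show ?thesis using W[OF i(1,2)] W[OF c] by linarith
  qed
  \<comment> \<open>Three plus signs in a row lower the walk by 4 k - 4 K, so 2 K is at least k.
    Together with \<open>K_small\<close> this is an equality, impossible for odd
    \<open>k\<close>.\<close>
  have nppp: "\<not> (z i = 1 \<and> z (cyc k i) = 1 \<and> z (cyc k (cyc k i)) = 1)" if i: "1 \<le> i" "i \<le> k" for i
  proof
    assume a: "z i = 1 \<and> z (cyc k i) = 1 \<and> z (cyc k (cyc k i)) = 1"
    have c: "1 \<le> cyc k i" "cyc k i \<le> k" using cyc_range i by auto
    have d: "1 \<le> cyc k (cyc k i)" "cyc k (cyc k i) \<le> k" using cyc_range c by auto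
    have "W (cyc k (cyc k i)) = W i + 4 * K - 4 * of_nat k"
      using step[OF i] step[OF c] a by simp
    then have "2 * K \<ge> of_nat k" using W[OF i] W[OF d] by linarith
    then have "2 * K = of_nat k" using K_small by simp
    then have "(of_nat (2 * k) :: rat) = of_nat (4 * q + k)" using Kq by simp
    then have "2 * k = 4 * q + k" by (simp only: of_nat_eq_iff)
    then show False using k(1) by presburger
  qed
  have nonneg: "z i + z (cyc k i) \<ge> 0" if "1 \<le> i" "i \<le> k" for i
    using nmm[OF that] unit[OF that] unit[of "cyc k i"] cyc_range[OF that] by auto
  \<comment> \<open>Without two adjacent plus signs the signs would alternate all around the cycle,
    and their sum would equal its own negative.\<close>
  have "\<exists>p. 1 \<le> p \<and> p \<le> k \<and> z p = 1 \<and> z (cyc k p) = 1"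
  proof (rule ccontr)
    assume no: "\<not> ?thesis"
    have "z (cyc k i) = - z i" if i: "1 \<le> i" "i \<le> k" for i
    proof (cases "z i = 1")
      case True
      then show ?thesis using no i unit[of "cyc k i"] cyc_range[OF i] by auto
    next
      case False
      then show ?thesis using nmm[OF i] unit[OF i] by auto
    qed
    then have "(\<Sum>i=1..k. z (cyc k i)) = (\<Sum>i=1..k. - z i)" by (intro sum.cong) auto
    then show False using pos unfolding sum_cyc sum_negf by simp
  qed
  then obtain p where p: "1 \<le> p" "p \<le> k" "z p = 1" "z (cyc k p) = 1" by blast
  \<comment> \<open>This rotation puts the plus pair at \<open>k - 1\<close> and \<open>k\<close>,
    the two vertices missing from the smaller copy.\<close>
  define t where "t = cyc k p"
  define y where "y = (\<lambda>i. z (rot k t i))"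
  have t: "1 \<le> t" "t \<le> k" using cyc_range p by (auto simp: t_def)
  have rt: "rot k t k = t" using rot_reaches t by simp
  have ck: "cyc k (k - 1) = k" using k by (simp add: cyc_def)
  have "cyc k (rot k t (k - 1)) = cyc k p"
    using rot_cyc[of "k - 1" k t] ck rt k by (simp add: t_def)
  then have rt1: "rot k t (k - 1) = p"
    by (rule cyc_inj[THEN iffD1, rotated 4]) (use rot_range[of "k - 1" k t] p(1,2) k in simp_all)
  have y_unit: "y i = 1 \<or> y i = -1" if "1 \<le> i" "i \<le> k" for i
    unfolding y_def by (rule unit) (use rot_range[OF that] in simp_all)
  have y_nmm: "y (cyc k i) = 1" if "1 \<le> i" "i \<le> k" "y i = -1" for i
    using nmm[of "rot k t i"] rot_range[OF that(1,2), of t] that(3)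
    unfolding y_def rot_cyc[OF that(1,2)] by blast
  have y_nppp: "\<not> (y i = 1 \<and> y (cyc k i) = 1 \<and> y (cyc k (cyc k i)) = 1)"
    if "1 \<le> i" "i \<le> k" for i
  proof -
    have "1 \<le> cyc k i" "cyc k i \<le> k" using cyc_range[OF that] by auto
    then show ?thesis
      using nppp[of "rot k t i"] rot_range[OF that, of t]
      unfolding y_def by (simp only: rot_cyc that) blast
  qed
  have y_top: "y (k - 1) = 1" "y k = 1" using p rt rt1 by (simp_all add: y_def t_def)
  have cs: "cyc k (k - 2) = k - 1" "cyc k (k - 3) = k - 2" "cyc k k = 1" "cyc k 1 = 2"
    using k by (auto simp: cyc_def)
  \<comment> \<open>From \<open>k - 3\<close> across the wrap to 2 the signs read
    \<open>+ - + + - +\<close>; deleting the middle pair leaves \<open>+ - - +\<close>.\<close>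
  have y1: "y 1 = -1" using y_nppp[of "k - 1"] y_top y_unit[of 1] k ck cs by auto
  have y2: "y 2 = 1" using y_nmm[of 1] y1 cs k by auto
  have yk2: "y (k - 2) = -1" using y_nppp[of "k - 2"] y_top y_unit[of "k - 2"] k ck cs by auto
  have "1 \<le> k - 3" using k by simp
  then have yk3: "y (k - 3) = 1" using y_nmm[of "k - 3"] y_unit[of "k - 3"] yk2 k cs by auto
  have Ky: "(\<Sum>i=1..k. y i) = K" unfolding y_def K_def by (rule sum_rot)
  \<comment> \<open>On the shorter cycle the signs sum to K - 2, and the three steps from
    \<open>k - 3\<close> to 2 rise by 6 (K - 2) + 2 (k - 2) = 2 k + 6 K - 16. For K at least 3 this
    exceeds the width 2 k.\<close>
  have K1: "K < 3"
  proof (rule ccontr)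
    assume "\<not> K < 3"
    have "(\<Sum>i=1..Suc (Suc (k - 2)). y i) = (\<Sum>i=1..k - 2. y i) + y (Suc (k - 2)) + y (Suc (Suc (k - 2)))"
      by simp
    moreover have "Suc (Suc (k - 2)) = k" "Suc (k - 2) = k - 1" using k by auto
    ultimately have sum: "(\<Sum>i=1..k - 2. y i) = K - 2" using Ky y_top by simp
    obtain W' where W': "\<And>i. 1 \<le> i \<Longrightarrow> i \<le> k - 2 \<Longrightarrow> \<bar>W' i\<bar> \<le> of_nat k"
      and step': "\<And>i. 1 \<le> i \<Longrightarrow> i \<le> k - 2 \<Longrightarrow>
        W' (cyc (k - 2) i) = W' i + 2 * (K - 2) - of_nat (k - 2) * (y i + y (cyc (k - 2) i))"
      using pot'[of t] unfolding potential_def y_def[symmetric] sum by blast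
    have cs': "cyc (k - 2) (k - 3) = k - 2" "cyc (k - 2) (k - 2) = 1" "cyc (k - 2) 1 = 2"
      using k by (auto simp: cyc_def)
    have le: "1 \<le> k - 3" "k - 3 \<le> k - 2" "1 \<le> k - 2" "k - 2 \<le> k - 2" "(1::nat) \<le> 1" "2 \<le> k - 2"
      using k by auto
    have W1: "W' (k - 2) = W' (k - 3) + 2 * (K - 2)"
      using step'[OF le(1,2)] cs' yk2 yk3 by simp
    have "W' 1 = W' (k - 2) + 2 * (K - 2) + 2 * of_nat (k - 2)"
      using step'[OF le(3,4)] cs' yk2 y1 by simp
    then have "W' 1 = W' (k - 2) + 2 * (K - 2) + 2 * (of_nat k - 2)"
      using k by (simp add: of_nat_diff)
    moreover note W1
    moreover have "W' 2 = W' 1 + 2 * (K - 2)"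
      using step'[OF le(5,3)] cs' y1 y2 by simp
    moreover have "\<bar>W' 2\<bar> \<le> of_nat k" "\<bar>W' (k - 3)\<bar> \<le> of_nat k"
      by (rule W', use k in simp, use k in simp)+
    ultimately show False using \<open>\<not> K < 3\<close> by (simp add: abs_le_iff)
  qed
  \<comment> \<open>\<open>K\<close> is an integer of the same parity as \<open>k\<close>, strictly
    between 0 and 3.\<close>
  have "K = 1"
  proof -
    have "2 * q < k" using Kq pos unfolding K_def[symmetric]
      by (metis diff_gt_0_iff_gt of_nat_less_iff of_nat_mult of_nat_numeral)
    moreover have "k < 2 * q + 3"
    proof -
      have "(of_nat k :: rat) < of_nat (2 * q + 3)" using Kq K1 by simp
      then show ?thesis by (simp only: of_nat_less_iff)
    qed
    ultimately have "k = 2 * q + 1" using k(1) by presburger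
    then show ?thesis using Kq by simp
  qed
  \<comment> \<open>Now the plus pair is placed at \<open>k\<close> and 1, across the wrap.\<close>
  define w where "w = (\<lambda>i. z (rot k p i))"
  have rp: "rot k p k = p" using rot_reaches p by simp
  have w1: "w 1 = 1" using rot_cyc[of k k p] rp p cs k by (simp add: w_def)
  have wk: "w k = 1" using rp p by (simp add: w_def)
  have w_nonneg: "w i + w (cyc k i) \<ge> 0" if "1 \<le> i" "i \<le> k" for i
    using nonneg[of "rot k p i"] rot_range[OF that] rot_cyc[OF that] by (simp add: w_def)
  have Kw: "(\<Sum>i=1..k. w i) = K" unfolding w_def K_def by (rule sum_rot)
  \<comment> \<open>The sums of adjacent signs are nonnegative with total 2, and the pair at the
    wrap already contributes 2. All other adjacent signs are therefore opposite.\<close>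
  have "(\<Sum>i=1..k. w i + w (cyc k i)) = 2 * K"
    unfolding sum.distrib sum_cyc Kw by simp
  moreover have "(\<Sum>i=1..k. w i + w (cyc k i)) = (\<Sum>i=1..k - 1. w i + w (cyc k i)) + 2"
  proof -
    have "(\<Sum>i=1..Suc (k - 1). w i + w (cyc k i))
        = (\<Sum>i=1..k - 1. w i + w (cyc k i)) + (w (Suc (k - 1)) + w (cyc k (Suc (k - 1))))"
      by simp
    moreover have "Suc (k - 1) = k" using k by simp
    ultimately show ?thesis using wk w1 cs by simp
  qed
  ultimately have "(\<Sum>i=1..k - 1. w i + w (cyc k i)) = 0" using \<open>K = 1\<close> by simp
  then have zero: "w i + w (cyc k i) = 0" if "1 \<le> i" "i < k" for i
    using that by (subst (asm) sum_nonneg_eq_0_iff) (auto intro!: w_nonneg)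
  have "1 \<le> i \<Longrightarrow> i \<le> k \<Longrightarrow> w i = (-1) ^ (i + 1)" for i
  proof (induction i rule: dec_induct)
    case (step i)
    have "w i + w (Suc i) = 0" using zero[of i] step by (simp add: cyc_def)
    then show ?case using step by (simp add: add_eq_0_iff)
  qed (use w1 in simp)
  then show "\<exists>t. \<forall>i. 1 \<le> i \<and> i \<le> k \<longrightarrow> z (rot k t i) = (-1) ^ (i + 1)"
    unfolding w_def by blast
qed

text \<open>A sum of an odd number of signs is nonzero, so either \<open>z\<close> or its negative
  has positive sum.\<close>

lemma sign_pattern:
  fixes z :: "nat \<Rightarrow> rat"
  assumes k: "odd k" "5 \<le> k"
    and unit: "\<And>i. 1 \<le> i \<Longrightarrow> i \<le> k \<Longrightarrow> z i = 1 \<or> z i = -1"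
    and pot: "potential k k z"
    and pot': "\<And>t. potential (k - 2) k (\<lambda>i. z (rot k t i))"
  shows "\<exists>s. (s = 1 \<or> s = -1) \<and> ((\<forall>i. 1 \<le> i \<and> i \<le> k \<longrightarrow> z i = s) \<or>
    (\<exists>t. \<forall>i. 1 \<le> i \<and> i \<le> k \<longrightarrow> z (rot k t i) = s * (-1) ^ (i + 1)))"
proof -
  have "(\<Sum>i=1..k. z i) = of_nat k - 2 * of_nat (card {i \<in> {1..k}. z i = -1})"
    using unit by (rule sum_signs)
  also have "\<dots> \<noteq> 0"
  proof
    assume "(of_nat k :: rat) - 2 * of_nat (card {i \<in> {1..k}. z i = -1}) = 0"
    then have "(of_nat k :: rat) = of_nat (2 * card {i \<in> {1..k}. z i = -1})" by simp
    then have "k = 2 * card {i \<in> {1..k}. z i = -1}" by (simp only: of_nat_eq_iff)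
    then show False using k(1) by (metis dvd_triv_left)
  qed
  finally consider "(\<Sum>i=1..k. z i) > 0" | "(\<Sum>i=1..k. - z i) > 0"
    unfolding sum_negf by linarith
  then show ?thesis
  proof cases
    case 1
    then show ?thesis using sign_pattern_pos[OF k unit 1 pot pot'] by (intro exI[of _ 1]) simp
  next
    case 2
    have unit': "\<And>i. 1 \<le> i \<Longrightarrow> i \<le> k \<Longrightarrow> - z i = 1 \<or> - z i = -1" using unit by force
    have eq: "- z i = c \<longleftrightarrow> z i = - 1 * c" for i c by auto
    show ?thesis
      using sign_pattern_pos[OF k unit' 2 potential_uminus[OF pot] potential_uminus[OF pot']]
      unfolding eq by (intro exI[of _ "-1"]) simp
  qed
qed

section \<open>Twins\<close>

text \<open>Arc signs replace arcs because a switch is then multiplication by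
  \<open>g u * g v\<close>, and the assumptions are stable under it.\<close>

locale signed_tournament =
  fixes V :: "'a set" and r :: "'a \<Rightarrow> 'a \<Rightarrow> rat" and k :: nat
  assumes skew: "u \<in> V \<Longrightarrow> v \<in> V \<Longrightarrow> r u v = - r v u"
    and unit: "u \<in> V \<Longrightarrow> v \<in> V \<Longrightarrow> u \<noteq> v \<Longrightarrow> r u v = 1 \<or> r u v = -1"
    and bound: "inj_on f {..<n} \<Longrightarrow> f ` {..<n} \<subseteq> V \<Longrightarrow> fdet n (\<lambda>i j. r (f i) (f j)) \<le> (of_nat k)\<^sup>2"
    and odd_k: "odd k" and k_ge: "5 \<le> k"
begin

lemma diag: "u \<in> V \<Longrightarrow> r u u = 0"
  using skew[of u u] by simp

definition embeds :: "nat \<Rightarrow> (nat \<Rightarrow> 'a) \<Rightarrow> bool" where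
  "embeds m e \<longleftrightarrow> inj_on e {..m} \<and> e ` {..m} \<subseteq> V \<and> (\<forall>i\<le>m. \<forall>j\<le>m. r (e i) (e j) = core i j)"

lemma embedsD:
  assumes "embeds m e"
  shows "inj_on e {..m}" "i \<le> m \<Longrightarrow> e i \<in> V" "i \<le> m \<Longrightarrow> j \<le> m \<Longrightarrow> r (e i) (e j) = core i j"
    "i \<le> m \<Longrightarrow> j \<le> m \<Longrightarrow> e i = e j \<longleftrightarrow> i = j"
  using assms by (auto simp: embeds_def inj_on_def)

lemma embeds_mono: "embeds m e \<Longrightarrow> l \<le> m \<Longrightarrow> embeds l e"
  by (auto simp: embeds_def inj_on_def)

lemma embeds_rot:
  assumes "embeds k e"
  shows "embeds k (\<lambda>i. e (rot k t i))"
  unfolding embeds_def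
proof (intro conjI allI impI)
  have "inj_on e (rot k t ` {..k})" using embedsD(1)[OF assms] by (simp add: rot_image)
  then show "inj_on (\<lambda>i. e (rot k t i)) {..k}"
    using comp_inj_on[OF rot_inj] by (simp add: comp_def)
  show "(\<lambda>i. e (rot k t i)) ` {..k} \<subseteq> V" using embedsD(2)[OF assms] rot_le by auto
  show "r (e (rot k t i)) (e (rot k t j)) = core i j" if "i \<le> k" "j \<le> k" for i j
    using embedsD(3)[OF assms, of "rot k t i" "rot k t j"] core_rot[OF odd_k that] rot_le that by simp
qed

text \<open>With \<open>u\<close> the solution for the signs of \<open>x\<close>, the walk is
  \<open>m\<close> times \<open>u\<close>: replacing vertex \<open>p\<close> by \<open>x\<close>
  gives the determinant (m u p)^2, which is at most k^2 for every \<open>m\<close>.\<close>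

lemma potential_embeds:
  assumes e: "embeds m e" and m: "odd m"
    and x: "x \<in> V" "x \<notin> e ` {..m}"
  shows "potential m k (\<lambda>i. r (e i) x)"
proof -
  let ?z = "\<lambda>i. r (e i) x"
  have m0: "of_nat m \<noteq> (0 :: rat)" using m by (auto intro!: Nat.gr0I)
  have "fdet (Suc m) core \<noteq> 0" using fdet_core[OF m] m0 by simp
  then obtain u where u: "\<And>i. i < Suc m \<Longrightarrow> (\<Sum>j<Suc m. core i j * u j) = ?z i"
    using fdet_solution[of "Suc m" core ?z] by blast
  have sys: "\<And>i. i \<le> m \<Longrightarrow> (\<Sum>j<Suc m. core i j * u j) = ?z i" by (rule u) simp
  have bnd: "\<bar>of_nat m * u p\<bar> \<le> of_nat k" if p: "p \<le> m" for p
  proof -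
    let ?f = "e(p := x)"
    have inj: "inj_on ?f {..<Suc m}"
      using embedsD(1)[OF e] x(2) by (auto simp: inj_on_def)
    have sub: "?f ` {..<Suc m} \<subseteq> V" using embedsD(2)[OF e] x(1) by auto
    have "fdet (Suc m) (\<lambda>i j. r (?f i) (?f j)) = fdet (Suc m) (\<lambda>i j. if i = p then if j = p then 0 else - ?z j
                       else if j = p then ?z i else core i j)"
    proof (rule fdet_cong)
      fix i j assume ij: "i < Suc m" "j < Suc m"
      have "r x (e j) = - r (e j) x" using skew[of x "e j"] x(1) embedsD(2)[OF e, of j] ij by simp
      then show "r (?f i) (?f j) = (if i = p then if j = p then 0 else - ?z j
                       else if j = p then ?z i else core i j)"
        using diag[OF x(1)] embedsD(3)[OF e, of i j] ij by simp
    qed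
    also have "\<dots> = (u p)\<^sup>2 * fdet (Suc m) core"
      by (rule fdet_replace_skew[OF core_skew u]) (use p in auto)
    also have "\<dots> = (of_nat m * u p)\<^sup>2" unfolding fdet_core[OF m] by (simp add: power_mult_distrib)
    finally have "(of_nat m * u p)\<^sup>2 \<le> (of_nat k)\<^sup>2" using bound[OF inj sub] by simp
    then show ?thesis using abs_le_square_iff[of "of_nat m * u p" "of_nat k"] by simp
  qed
  have step: "of_nat m * u (cyc m i) = of_nat m * u i + 2 * (\<Sum>j=1..m. ?z j) - of_nat m * (?z i + ?z (cyc m i))"
    if i: "1 \<le> i" "i \<le> m" for i
  proof -
    have "u (cyc m i) = u i - 2 * u 0 - (?z i + ?z (cyc m i))" by (rule core_system_step[OF m sys i])
    then have "of_nat m * u (cyc m i) = of_nat m * (u i - 2 * u 0 - (?z i + ?z (cyc m i)))"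
      by (simp only:)
    then have "of_nat m * u (cyc m i) = of_nat m * u i - 2 * (of_nat m * u 0) - of_nat m * (?z i + ?z (cyc m i))"
      by (simp add: right_diff_distrib)
    moreover have "of_nat m * u 0 = - (\<Sum>j=1..m. ?z j)" by (rule core_system_apex[OF m sys])
    ultimately show ?thesis by simp
  qed
  show ?thesis unfolding potential_def
    by (rule exI[of _ "\<lambda>i. of_nat m * u i"]) (use bnd step in auto)
qed

text \<open>Each pattern of \<open>sign_pattern\<close> is a column of \<open>core\<close> up to
  sign. A constant pattern is the column of the apex, whose entries on the cycle are -1; hence the
  sign \<open>- s\<close>.\<close>

lemma twin_exists:
  assumes e: "embeds k e" and x: "x \<in> V" "x \<notin> e ` {..k}"
  shows "\<exists>s p. (s = 1 \<or> s = -1) \<and> p \<le> k \<and> (\<forall>i\<le>k. i \<noteq> p \<longrightarrow> r (e i) x = s * r (e i) (e p))"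
proof -
  let ?z = "\<lambda>i. r (e i) x"
  have z_unit: "?z i = 1 \<or> ?z i = -1" if "i \<le> k" for i
    using unit[of "e i" x] embedsD(2)[OF e that] x that by blast
  have pot: "potential k k ?z" by (rule potential_embeds[OF e odd_k x])
  have pot': "potential (k - 2) k (\<lambda>i. ?z (rot k t i))" for t
  proof (rule potential_embeds)
    show "embeds (k - 2) (\<lambda>i. e (rot k t i))" by (rule embeds_mono[OF embeds_rot[OF e]]) simp
    show "odd (k - 2)" using odd_k k_ge by simp
    show "x \<in> V" by fact
    show "x \<notin> (\<lambda>i. e (rot k t i)) ` {..k - 2}"
    proof
      assume "x \<in> (\<lambda>i. e (rot k t i)) ` {..k - 2}"
      then obtain i where "i \<le> k - 2" "x = e (rot k t i)" by auto
      then show False using x(2) rot_le[of i k t] by simp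
    qed
  qed
  obtain s where s: "s = 1 \<or> s = -1"
    and alt: "(\<forall>i. 1 \<le> i \<and> i \<le> k \<longrightarrow> ?z i = s) \<or>
      (\<exists>t. \<forall>i. 1 \<le> i \<and> i \<le> k \<longrightarrow> ?z (rot k t i) = s * (-1) ^ (i + 1))"
    using sign_pattern[OF odd_k k_ge z_unit pot pot'] by auto
  from alt show ?thesis
  proof
    assume all: "\<forall>i. 1 \<le> i \<and> i \<le> k \<longrightarrow> ?z i = s"
    have "?z i = - s * r (e i) (e 0)" if "i \<le> k" "i \<noteq> 0" for i
      using all that embedsD(3)[OF e, of i 0] by (simp add: core_def)
    then show ?thesis using s by (intro exI[of _ "- s"] exI[of _ 0]) auto
  next
    assume "\<exists>t. \<forall>i. 1 \<le> i \<and> i \<le> k \<longrightarrow> ?z (rot k t i) = s * (-1) ^ (i + 1)"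
    then obtain t where t: "\<And>i. 1 \<le> i \<Longrightarrow> i \<le> k \<Longrightarrow> ?z (rot k t i) = s * (-1) ^ (i + 1)" by blast
    \<comment> \<open>Off their diagonal entries, the columns \<open>k\<close> and 1 of
      \<open>core\<close> alternate on the cycle with opposite signs, while both are 1 at the apex.
      The sign between \<open>x\<close> and the apex decides which of the two fits.\<close>
    have *: "\<exists>s' p. (s' = 1 \<or> s' = -1) \<and> p \<le> k \<and> (\<forall>i\<le>k. i \<noteq> p \<longrightarrow> ?z (rot k t i) = s' * core i p)"
    proof (cases "?z 0 = s")
      case True
      have "?z (rot k t i) = s * core i k" if "i \<le> k" "i \<noteq> k" for i
        using t[of i] that True odd_k by (cases "i = 0") (auto simp: core_def minus_one_power_iff)
      then show ?thesis using s by blast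
    next
      case False
      then have z0: "?z 0 = - s" using z_unit[of 0] s by auto
      have "?z (rot k t i) = - s * core i 1" if "i \<le> k" "i \<noteq> 1" for i
        using t[of i] that z0 by (cases "i = 0") (auto simp: core_def minus_one_power_iff)
      then show ?thesis using s k_ge by (intro exI[of _ "- s"] exI[of _ 1]) auto
    qed
    then obtain s' p where sp: "s' = 1 \<or> s' = -1" "p \<le> k"
      "\<And>i. i \<le> k \<Longrightarrow> i \<noteq> p \<Longrightarrow> ?z (rot k t i) = s' * core i p" by blast
    have "?z i = s' * r (e i) (e (rot k t p))" if i: "i \<le> k" "i \<noteq> rot k t p" for i
    proof -
      obtain j where j: "j \<le> k" "i = rot k t j" using i(1) rot_image[of k t] by (metis atMost_iff imageE)
      then have "?z i = s' * core j p" using sp(3)[of j] i(2) by auto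
      also have "core j p = r (e i) (e (rot k t p))"
        using embedsD(3)[OF embeds_rot[OF e], of j p] j sp(2) by simp
      finally show ?thesis .
    qed
    then show ?thesis using sp rot_le by blast
  qed
qed

text \<open>Adding both twins to the copy multiplies the determinant k^2 by the square in
  \<open>fdet_extend_twins\<close>, so the squared expression has absolute value at most 1. In the
  second claim the sum is 3 or -3 exactly when the three vertices form a 3-cycle.\<close>

lemma twin_pair:
  assumes e: "embeds k e"
    and x: "x \<in> V" "x \<notin> e ` {..k}" and y: "y \<in> V" "y \<notin> e ` {..k}" and xy: "x \<noteq> y"
    and p: "p \<le> k" and q: "q \<le> k"
    and X: "\<And>i. i \<le> k \<Longrightarrow> i \<noteq> p \<Longrightarrow> r (e i) x = r (e i) (e p)"
    and Y: "\<And>i. i \<le> k \<Longrightarrow> i \<noteq> q \<Longrightarrow> r (e i) y = r (e i) (e q)"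
  shows "p \<noteq> q \<Longrightarrow> r x y = r (e p) (e q)"
    and "p = q \<Longrightarrow> \<bar>r x y + r y (e p) + r (e p) x\<bar> \<le> 1"
proof -
  let ?f = "e(Suc k := x, Suc k + 1 := y)"
  let ?M = "\<lambda>i j. r (?f i) (?f j)"
  let ?a = "r (e p) x" and ?b = "r (e q) y"
  have inj: "inj_on ?f {..<Suc k + 2}"
    using embedsD(1)[OF e] x(2) y(2) xy by (auto simp: inj_on_def less_Suc_eq_le le_Suc_eq)
  have sub: "?f ` {..<Suc k + 2} \<subseteq> V"
    using embedsD(2)[OF e] x(1) y(1) by (auto simp: less_Suc_eq_le le_Suc_eq)
  have base: "fdet (Suc k) ?M = fdet (Suc k) core"
    by (rule fdet_cong) (use embedsD(3)[OF e] in auto)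
  have k0: "(of_nat k :: rat) \<noteq> 0" using k_ge by simp
  have nz: "fdet (Suc k) core \<noteq> 0" using fdet_core[OF odd_k] k0 by simp
  obtain s where s: "\<And>i. i < Suc k \<Longrightarrow> (\<Sum>j<Suc k. core i j * s j) = of_bool (i = q)"
    using fdet_solution[OF nz, of "\<lambda>i. of_bool (i = q)"] by blast
  have small: "\<bar>s p\<bar> < 1"
    by (rule core_inverse_small[OF odd_k _ s _ _]) (use k_ge p q in auto)
  have sM: "(\<Sum>j<Suc k. ?M i j * s j) = of_bool (i = q)" if "i < Suc k" for i
  proof -
    have "(\<Sum>j<Suc k. ?M i j * s j) = (\<Sum>j<Suc k. core i j * s j)"
      by (rule sum.cong) (use that embedsD(3)[OF e, of i] in auto)
    then show ?thesis using s[OF that] by simp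
  qed
  have "fdet (Suc k + 2) ?M = fdet (Suc k) ?M * (?M (Suc k) (Suc k + 1) - ?M p q
      + (?a - ?b) * of_bool (p = q) + ?a * ?b * s p)\<^sup>2"
  proof (rule fdet_extend_twins[OF _ _ _ _ _ _ sM])
    show "?M i j = - ?M j i" if "i < Suc k + 2" "j < Suc k + 2" for i j
      by (rule skew) (use sub that in auto)
    show "fdet (Suc k) ?M \<noteq> 0" using base nz by simp
    show "?M i (Suc k) = ?M i p + ?a * of_bool (i = p)" if "i < Suc k" for i
      using X[of i] that p diag[OF embedsD(2)[OF e p]] by auto
    show "?M i (Suc k + 1) = ?M i q + ?b * of_bool (i = q)" if "i < Suc k" for i
      using Y[of i] that q diag[OF embedsD(2)[OF e q]] by auto
  qed (use p q in auto)
  also have "\<dots> = (of_nat k)\<^sup>2 * (r x y - r (e p) (e q) + (?a - ?b) * of_bool (p = q) + ?a * ?b * s p)\<^sup>2"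
    unfolding base fdet_core[OF odd_k] using p q by simp
  finally have "(of_nat k)\<^sup>2 * (r x y - r (e p) (e q) + (?a - ?b) * of_bool (p = q) + ?a * ?b * s p)\<^sup>2
      \<le> (of_nat k)\<^sup>2 * 1" using bound[OF inj sub] by simp
  then have "(r x y - r (e p) (e q) + (?a - ?b) * of_bool (p = q) + ?a * ?b * s p)\<^sup>2 \<le> 1"
    by (rule mult_left_le_imp_le) (use k_ge in simp)
  then have main: "\<bar>r x y - r (e p) (e q) + (?a - ?b) * of_bool (p = q) + ?a * ?b * s p\<bar> \<le> 1"
    by (simp add: abs_square_le_1)
  have ab: "?a = 1 \<or> ?a = -1" "?b = 1 \<or> ?b = -1" "r x y = 1 \<or> r x y = -1"
    using unit[of "e p" x] unit[of "e q" y] unit[OF x(1) y(1) xy] x y embedsD(2)[OF e p] embedsD(2)[OF e q] p q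
    by auto
  \<comment> \<open>A wrong arc would contribute 2 or -2, and the remaining term is less than 1 in
    absolute value by \<open>small\<close>.\<close>
  show "r x y = r (e p) (e q)" if "p \<noteq> q"
  proof -
    have "r (e p) (e q) = 1 \<or> r (e p) (e q) = -1"
      using unit[of "e p" "e q"] embedsD(2,4)[OF e] p q that by blast
    then show ?thesis using main small that ab by auto
  qed
  \<comment> \<open>Here \<open>s p\<close> is a diagonal entry of the inverse of a skew matrix and
    vanishes, so only the three arc signs remain.\<close>
  show "\<bar>r x y + r y (e p) + r (e p) x\<bar> \<le> 1" if "p = q"
  proof -
    have "(\<Sum>i<Suc k. s i * of_bool (i = q)) = (\<Sum>i<Suc k. s i * (\<Sum>j<Suc k. core i j * s j))"
      by (rule sum.cong) (use s in auto)
    also have "\<dots> = 0" by (rule skew_quadratic_form_zero) (rule core_skew)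
    also have "(\<Sum>i<Suc k. s i * of_bool (i = q)) = s q"
      using q by (simp add: of_bool_def if_distrib cong: if_cong del: sum.lessThan_Suc)
    finally have "s p = 0" using that by simp
    then show ?thesis
      using main that skew[OF y(1) embedsD(2)[OF e p]] diag[OF embedsD(2)[OF e p]] by (simp add: algebra_simps)
  qed
qed

end

section \<open>Switching invariance and the classes of twins\<close>

lemma fdet_switch:
  fixes g :: "nat \<Rightarrow> rat"
  assumes "\<And>i. i < n \<Longrightarrow> g i = 1 \<or> g i = -1"
  shows "fdet n (\<lambda>i j. g i * g j * M i j) = fdet n M"
proof -
  let ?A = "mat n n (\<lambda>(i, j). M i j)"
  let ?D = "mat n n (\<lambda>(i, j). g i * g j * M i j)"
  \<comment> \<open>A permutation meets each row and each column once, so every sign enters its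
    product twice.\<close>
  have prod_g: "(\<Prod>i=0..<n. g i * g (p i)) = 1" if "p permutes {0..<n}" for p
  proof -
    have "(\<Prod>i=0..<n. g (p i)) = (\<Prod>i=0..<n. g i)"
      using prod.permute[OF that, of g] by (simp add: comp_def)
    moreover have "(\<Prod>i=0..<n. g i) * (\<Prod>i=0..<n. g i) = 1"
      unfolding prod.distrib[symmetric] by (rule prod.neutral) (use assms in fastforce)
    ultimately show ?thesis by (simp add: prod.distrib)
  qed
  have "det ?D = (\<Sum>p | p permutes {0..<n}. signof p * (\<Prod>i=0..<n. ?D $$ (i, p i)))"
    by (rule det_def') simp
  also have "\<dots> = (\<Sum>p | p permutes {0..<n}. signof p * (\<Prod>i=0..<n. ?A $$ (i, p i)))"
  proof (rule sum.cong)
    fix p assume "p \<in> {p. p permutes {0..<n}}"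
    then have p: "p permutes {0..<n}" by simp
    have lt: "p i < n" if "i < n" for i using permutes_in_image[OF p, of i] that by simp
    have "(\<Prod>i=0..<n. ?D $$ (i, p i)) = (\<Prod>i=0..<n. (g i * g (p i)) * ?A $$ (i, p i))"
      by (rule prod.cong) (use lt in auto)
    also have "\<dots> = (\<Prod>i=0..<n. ?A $$ (i, p i))"
      unfolding prod.distrib[of "\<lambda>i. g i * g (p i)"] using prod_g[OF p] by simp
    finally show "signof p * (\<Prod>i=0..<n. ?D $$ (i, p i)) = signof p * (\<Prod>i=0..<n. ?A $$ (i, p i))"
      by simp
  qed simp
  also have "\<dots> = det ?A" by (rule det_def'[symmetric]) simp
  finally show ?thesis .
qed

context signed_tournament
begin

lemma switched:
  assumes g: "\<And>v. v \<in> V \<Longrightarrow> g v = 1 \<or> g v = -1"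
  shows "signed_tournament V (\<lambda>u v. g u * g v * r u v) k"
proof
  show "g u * g v * r u v = - (g v * g u * r v u)" if "u \<in> V" "v \<in> V" for u v
    using skew[OF that] by simp
  show "g u * g v * r u v = 1 \<or> g u * g v * r u v = -1" if "u \<in> V" "v \<in> V" "u \<noteq> v" for u v
    using unit[OF that] g[OF that(1)] g[OF that(2)] by auto
  show "fdet n (\<lambda>i j. g (f i) * g (f j) * r (f i) (f j)) \<le> (of_nat k)\<^sup>2"
    if f: "inj_on f {..<n}" "f ` {..<n} \<subseteq> V" for f n
  proof -
    have "fdet n (\<lambda>i j. g (f i) * g (f j) * r (f i) (f j)) = fdet n (\<lambda>i j. r (f i) (f j))"
      by (rule fdet_switch) (use f g in auto)
    then show ?thesis using bound[OF f] by simp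
  qed
qed (fact odd_k k_ge)+

text \<open>\<open>twin_pair\<close> speaks of vertices outside the copy and compares twins with the
  representative \<open>e p\<close>. Here the vertices are arbitrary; any member of a class can take
  over the role of its representative.\<close>

lemma twin_classes:
  assumes e: "embeds k e"
    and t: "\<And>v. v \<in> V \<Longrightarrow> t v \<le> k"
    and te: "\<And>i. i \<le> k \<Longrightarrow> t (e i) = i"
    and tw: "\<And>v i. v \<in> V \<Longrightarrow> i \<le> k \<Longrightarrow> i \<noteq> t v \<Longrightarrow> r (e i) v = core i (t v)"
  shows "u \<in> V \<Longrightarrow> v \<in> V \<Longrightarrow> t u \<noteq> t v \<Longrightarrow> r u v = core (t u) (t v)"
    and "u \<in> V \<Longrightarrow> v \<in> V \<Longrightarrow> w \<in> V \<Longrightarrow> t u = t v \<Longrightarrow> t u = t w \<Longrightarrow> distinct [u, v, w] \<Longrightarrow>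
      \<bar>r u v + r v w + r w u\<bar> \<le> 1"
proof -
  have X: "r (e i) v = r (e i) (e (t v))" if "v \<in> V" "i \<le> k" "i \<noteq> t v" for i v
    using tw[OF that] embedsD(3)[OF e that(2) t[OF that(1)]] by simp
  show "r u v = core (t u) (t v)" if uv: "u \<in> V" "v \<in> V" "t u \<noteq> t v" for u v
  proof (cases "u \<in> e ` {..k}")
    case True
    then obtain i where i: "i \<le> k" "u = e i" by auto
    then show ?thesis using tw[OF uv(2), of i] uv(3) te by simp
  next
    case u: False
    show ?thesis
    proof (cases "v \<in> e ` {..k}")
      case True
      then obtain i where i: "i \<le> k" "v = e i" by auto
      have "r u v = - r v u" by (rule skew[OF uv(1,2)])
      also have "r v u = core i (t u)" using tw[OF uv(1), of i] uv(3) te i by simp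
      also have "- core i (t u) = core (t u) i" using core_skew[of "t u" i] by simp
      finally show ?thesis using te i by simp
    next
      case False
      have "r u v = r (e (t u)) (e (t v))"
        by (rule twin_pair(1)[OF e uv(1) u uv(2) False _ t[OF uv(1)] t[OF uv(2)]])
          (use uv X in auto)
      then show ?thesis using embedsD(3)[OF e t[OF uv(1)] t[OF uv(2)]] by simp
    qed
  qed
  have base: "\<bar>r v w + r w u + r u v\<bar> \<le> 1"
    if V: "u \<in> V" "v \<in> V" "w \<in> V" and eq: "t u = t v" "t u = t w" and d: "distinct [u, v, w]"
      and v: "v \<notin> e ` {..k}" and w: "w \<notin> e ` {..k}" for u v w
  proof -
    let ?p = "t u"
    have p: "?p \<le> k" by (rule t[OF V(1)])
    have u: "u \<in> e ` {..k} \<longleftrightarrow> u = e ?p" using te p by auto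
    \<comment> \<open>\<open>u\<close> has the same signs as \<open>e ?p\<close> towards the rest of
      the copy, so exchanging them gives another copy.\<close>
    let ?e = "e(?p := u)"
    have row: "r (e i) u = core i ?p" if "i \<le> k" "i \<noteq> ?p" for i by (rule tw[OF V(1) that])
    have "embeds k ?e"
      unfolding embeds_def
    proof (intro conjI allI impI)
      show "inj_on ?e {..k}" using embedsD(1)[OF e] u te by (auto simp: inj_on_def)
      show "?e ` {..k} \<subseteq> V" using V(1) embedsD(2)[OF e] by auto
      show "r (?e i) (?e j) = core i j" if "i \<le> k" "j \<le> k" for i j
      proof -
        have "r u (e j) = - r (e j) u" by (rule skew[OF V(1) embedsD(2)[OF e that(2)]])
        then show ?thesis
          using that row[of i] row[of j] embedsD(3)[OF e that] core_skew[of ?p j] diag[OF V(1)] by auto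
      qed
    qed
    moreover have "v \<notin> ?e ` {..k}" "w \<notin> ?e ` {..k}" using v w d by auto
    moreover have "r (?e i) v = r (?e i) (?e ?p)" "r (?e i) w = r (?e i) (?e ?p)" if "i \<le> k" "i \<noteq> ?p" for i
      using tw[OF V(2), of i] tw[OF V(3), of i] row[of i] that eq by auto
    ultimately have "\<bar>r v w + r w (?e ?p) + r (?e ?p) v\<bar> \<le> 1"
      using V d p by (intro twin_pair(2)[of ?e v w ?p ?p]) auto
    then show ?thesis by simp
  qed
  show "\<bar>r u v + r v w + r w u\<bar> \<le> 1"
    if V: "u \<in> V" "v \<in> V" "w \<in> V" and eq: "t u = t v" "t u = t w" and d: "distinct [u, v, w]" for u v w
  proof -
    have one: "a = b" if "a \<in> e ` {..k}" "b \<in> e ` {..k}" "t a = t b" for a b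
      using that te by auto
    \<comment> \<open>A class has only one vertex in the copy, so at least two of the three lie
      outside; the sum is invariant under cyclic relabelling, which reduces everything to
      \<open>base\<close>.\<close>
    have "v \<notin> e ` {..k} \<or> w \<notin> e ` {..k}" "w \<notin> e ` {..k} \<or> u \<notin> e ` {..k}"
      "u \<notin> e ` {..k} \<or> v \<notin> e ` {..k}"
      using one[of v w] one[of u w] one[of u v] d eq by auto
    then consider "v \<notin> e ` {..k}" "w \<notin> e ` {..k}" | "w \<notin> e ` {..k}" "u \<notin> e ` {..k}"
      | "u \<notin> e ` {..k}" "v \<notin> e ` {..k}"
      by blast
    then show ?thesis
    proof cases
      case 1
      then show ?thesis using base[OF V eq d 1] by (simp only: add.commute add.left_commute)
    next
      case 2
      have c: "t v = t w" "t v = t u" "distinct [v, w, u]" using eq d by auto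
      then show ?thesis using base[OF V(2,3,1) c 2] by (simp only: add.commute add.left_commute)
    next
      case 3
      have c: "t w = t u" "t w = t v" "distinct [w, u, v]" using eq d by auto
      then show ?thesis using base[OF V(3,1,2) c 3] by (simp only: add.commute add.left_commute)
    qed
  qed
qed

text \<open>A vertex agrees with its twin only up to a sign. Switching by these signs makes the
  agreement exact, as \<open>twin_classes\<close> requires.\<close>

lemma blowup_structure:
  assumes e: "embeds k e"
  obtains g t where
    "\<And>v. v \<in> V \<Longrightarrow> g v = 1 \<or> g v = -1"
    "\<And>v. v \<in> V \<Longrightarrow> t v \<le> k"
    "\<And>i. i \<le> k \<Longrightarrow> t (e i) = i"
    "\<And>u v. u \<in> V \<Longrightarrow> v \<in> V \<Longrightarrow> t u \<noteq> t v \<Longrightarrow> g u * g v * r u v = core (t u) (t v)"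
    "\<And>u v w. u \<in> V \<Longrightarrow> v \<in> V \<Longrightarrow> w \<in> V \<Longrightarrow> t u = t v \<Longrightarrow> t u = t w \<Longrightarrow> distinct [u, v, w] \<Longrightarrow>
      \<bar>g u * g v * r u v + g v * g w * r v w + g w * g u * r w u\<bar> \<le> 1"
proof -
  have "\<forall>x\<in>V - e ` {..k}. \<exists>q. (fst q = 1 \<or> fst q = -1) \<and> snd q \<le> k \<and>
      (\<forall>i\<le>k. i \<noteq> snd q \<longrightarrow> r (e i) x = fst q * r (e i) (e (snd q)))"
    using twin_exists[OF e] by (auto simp: split_paired_Ex)
  then obtain q where q: "\<forall>x\<in>V - e ` {..k}. (fst (q x) = 1 \<or> fst (q x) = -1) \<and> snd (q x) \<le> k \<and>
      (\<forall>i\<le>k. i \<noteq> snd (q x) \<longrightarrow> r (e i) x = fst (q x) * r (e i) (e (snd (q x))))"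
    by (elim bchoice[THEN exE])
  define s where "s = (\<lambda>x. fst (q x))"
  define p where "p = (\<lambda>x. snd (q x))"
  have sp: "\<And>x. x \<in> V \<Longrightarrow> x \<notin> e ` {..k} \<Longrightarrow> s x = 1 \<or> s x = -1"
    "\<And>x. x \<in> V \<Longrightarrow> x \<notin> e ` {..k} \<Longrightarrow> p x \<le> k"
    "\<And>x i. x \<in> V \<Longrightarrow> x \<notin> e ` {..k} \<Longrightarrow> i \<le> k \<Longrightarrow> i \<noteq> p x \<Longrightarrow> r (e i) x = s x * r (e i) (e (p x))"
    using q by (simp_all add: s_def p_def)
  \<comment> \<open>The copy itself is left unswitched, so it is still a copy of \<open>core\<close>
    afterwards.\<close>
  define g where "g = (\<lambda>v. if v \<in> e ` {..k} then 1 else s v)"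
  define t where "t = (\<lambda>v. if v \<in> e ` {..k} then the_inv_into {..k} e v else p v)"
  have g: "g v = 1 \<or> g v = -1" if "v \<in> V" for v using sp(1)[OF that] by (auto simp: g_def)
  have ge: "g (e i) = 1" if "i \<le> k" for i using that by (simp add: g_def)
  have te: "t (e i) = i" if "i \<le> k" for i
    using that the_inv_into_f_f[OF embedsD(1)[OF e], of i] by (simp add: t_def)
  have t: "t v \<le> k" if "v \<in> V" for v
  proof (cases "v \<in> e ` {..k}")
    case True then show ?thesis using te by auto
  next
    case False then show ?thesis using sp(2)[OF that] by (simp add: t_def)
  qed
  let ?r = "\<lambda>u v. g u * g v * r u v"
  interpret R: signed_tournament V ?r k by (rule switched[OF g])
  have Re: "R.embeds k e"
    unfolding R.embeds_def using embedsD(1-3)[OF e] ge by auto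
  have tw: "?r (e i) v = core i (t v)" if v: "v \<in> V" and i: "i \<le> k" "i \<noteq> t v" for v i
  proof (cases "v \<in> e ` {..k}")
    case True
    then obtain j where j: "j \<le> k" "v = e j" by auto
    then show ?thesis using embedsD(3)[OF e, of i j] te ge i by simp
  next
    case False
    then have "t v = p v" "g v = s v" by (simp_all add: t_def g_def)
    then have "?r (e i) v = s v * s v * r (e i) (e (t v))"
      using sp(3)[OF v False, of i] i ge by simp
    also have "s v * s v = 1" using sp(1)[OF v False] by auto
    finally show ?thesis using embedsD(3)[OF e i(1) t[OF v]] by simp
  qed
  show thesis
    by (rule that[OF g t te R.twin_classes(1)[OF Re t te tw] R.twin_classes(2)[OF Re t te tw]])
qed

end

section \<open>Tournaments, switching and blowups\<close>

definition arc_sign :: "'a pair_pre_digraph \<Rightarrow> 'a \<Rightarrow> 'a \<Rightarrow> rat" where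
  "arc_sign T u v = (if (u, v) \<in> parcs T then 1 else if (v, u) \<in> parcs T then -1 else 0)"

lemma arc_sign_eq_one: "arc_sign T u v = 1 \<longleftrightarrow> (u, v) \<in> parcs T"
  by (simp add: arc_sign_def)

lemma (in tournament) arc_sign_skew: "arc_sign T u v = - arc_sign T v u"
  unfolding arc_sign_def using arcs_asym[of u v] by simp

lemma (in tournament) arc_sign_unit:
  "u \<in> pverts T \<Longrightarrow> v \<in> pverts T \<Longrightarrow> u \<noteq> v \<Longrightarrow> arc_sign T u v = 1 \<or> arc_sign T u v = -1"
  unfolding arc_sign_def using arcs_total[of u v] by auto

lemma arc_sign_switch:
  assumes "tournament T"
  shows "arc_sign (switch T W) u v =
    (if u \<in> W then -1 else 1) * (if v \<in> W then -1 else 1) * arc_sign T u v"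
proof -
  interpret tournament T by fact
  have "(x, y) \<in> parcs (switch T W) \<longleftrightarrow> (if x \<in> W \<longleftrightarrow> y \<in> W then (x, y) \<in> parcs T else (y, x) \<in> parcs T)" for x y
    by (auto simp: switch_def)
  then show ?thesis
    unfolding arc_sign_def using arcs_asym[of u v] by (cases "u \<in> W"; cases "v \<in> W") simp_all
qed

definition induced :: "'a pair_pre_digraph \<Rightarrow> 'a set \<Rightarrow> 'a pair_pre_digraph" where
  "induced T A = \<lparr>pverts = A, parcs = parcs T \<inter> A \<times> A\<rparr>"

lemma subtournament_induced:
  assumes "tournament T" "A \<subseteq> pverts T"
  shows "subtournament (induced T A) T"
proof -
  interpret tournament T by fact
  have "wf_digraph (with_proj (induced T A))"
    by unfold_locales (auto simp: induced_def)
  moreover have "wf_digraph (with_proj T)"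
    by unfold_locales
  ultimately show ?thesis
    using assms(2)
    by (auto simp: subtournament_def induced_subgraph_def subgraph_def compatible_def induced_def)
qed

lemma subtournamentD:
  assumes "subtournament S T"
  shows "pverts S \<subseteq> pverts T" "parcs S = parcs T \<inter> pverts S \<times> pverts S"
  using assms by (auto simp: subtournament_def induced_subgraph_def subgraph_def)

lemma fdet_arc_sign_le:
  assumes T: "T \<in> tournaments_D k" and f: "inj_on f {..<n}" "f ` {..<n} \<subseteq> pverts T"
  shows "fdet n (\<lambda>i j. arc_sign T (f i) (f j)) \<le> (of_nat k)\<^sup>2"
proof -
  have tour: "tournament T" using T by (simp add: tournaments_D_def)
  let ?vs = "map f [0..<n]"
  let ?S = "induced T (f ` {..<n})"
  have "tournament_det ?S \<le> (int k)\<^sup>2"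
    using T subtournament_induced[OF tour f(2)] by (simp add: tournaments_D_def)
  moreover have "tournament_det ?S = det (skew_adjacency ?S ?vs)"
    by (rule tournament_det_eq)
      (use f in \<open>auto simp: vertex_ordering_def induced_def distinct_map inj_on_def\<close>)
  moreover have M: "map_mat rat_of_int (skew_adjacency ?S ?vs) = mat n n (\<lambda>(i, j). arc_sign T (f i) (f j))"
    by (rule eq_matI) (auto simp: skew_adjacency_def arc_sign_def induced_def)
  then have "fdet n (\<lambda>i j. arc_sign T (f i) (f j)) = rat_of_int (det (skew_adjacency ?S ?vs))"
    using of_int_hom.hom_det[of "skew_adjacency ?S ?vs", where 'a = rat] unfolding M by simp
  ultimately have "fdet n (\<lambda>i j. arc_sign T (f i) (f j)) \<le> rat_of_int ((int k)\<^sup>2)"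
    by (simp only: of_int_le_iff)
  then show ?thesis by simp
qed

section \<open>Isomorphisms and transitive blowups\<close>

lemma isomorphicI:
  assumes "tournament S" "tournament T"
    and f: "bij_betw f (pverts S) (pverts T)"
    and arcs: "\<And>u v. u \<in> pverts S \<Longrightarrow> v \<in> pverts S \<Longrightarrow> (u, v) \<in> parcs S \<longleftrightarrow> (f u, f v) \<in> parcs T"
  shows "isomorphic S T"
proof -
  interpret S: tournament S by fact
  interpret T: tournament T by fact
  \<comment> \<open>Arcs are pairs of vertices, so the vertex map forces the arc map.\<close>
  let ?h = "\<lparr>iso_verts = f, iso_arcs = map_prod f f, iso_head = snd, iso_tail = fst\<rparr>"
  have "inj_on (map_prod f f) (pverts S \<times> pverts S)"
    using f by (intro map_prod_inj_on) (auto simp: bij_betw_def)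
  moreover have sub: "parcs S \<subseteq> pverts S \<times> pverts S"
    using S.in_arcsD1 S.in_arcsD2 by auto
  ultimately have "inj_on (map_prod f f) (parcs S)" by (rule inj_on_subset)
  moreover have "wf_digraph (with_proj S)" by unfold_locales
  ultimately have iso: "pre_digraph.digraph_isomorphism (with_proj S) ?h"
    using f by (auto simp: pre_digraph.digraph_isomorphism_def bij_betw_def)
  have "map_prod f f ` parcs S = parcs T"
  proof (intro equalityI subsetI)
    fix a assume "a \<in> map_prod f f ` parcs S"
    then obtain u v where "(u, v) \<in> parcs S" "a = (f u, f v)" by auto
    then show "a \<in> parcs T" using arcs[of u v] sub by blast
  next
    fix a assume a: "a \<in> parcs T"
    then have "fst a \<in> f ` pverts S" "snd a \<in> f ` pverts S"
      using T.in_arcsD1[of "fst a" "snd a"] T.in_arcsD2[of "fst a" "snd a"] f by (auto simp: bij_betw_def)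
    then obtain u v where uv: "u \<in> pverts S" "v \<in> pverts S" "a = (f u, f v)"
      by (auto simp: prod_eq_iff)
    then have "(u, v) \<in> parcs S" using a arcs[of u v] by simp
    then show "a \<in> map_prod f f ` parcs S" using uv(3) by (intro image_eqI[of _ _ "(u, v)"]) simp_all
  qed
  then have "with_proj T = app_iso ?h (with_proj S)"
    using f by (simp add: app_iso_def with_proj_def bij_betw_def)
  then show ?thesis using iso unfolding isomorphic_def digraph_iso_def by blast
qed

lemma isomorphicD:
  assumes "isomorphic S T" "tournament S"
  obtains f where "bij_betw f (pverts S) (pverts T)"
    "\<And>u v. u \<in> pverts S \<Longrightarrow> v \<in> pverts S \<Longrightarrow> (u, v) \<in> parcs S \<longleftrightarrow> (f u, f v) \<in> parcs T"
proof -
  interpret tournament S by fact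
  obtain h where h: "pre_digraph.digraph_isomorphism (with_proj S) h" "with_proj T = app_iso h (with_proj S)"
    using assms(1) unfolding isomorphic_def digraph_iso_def by blast
  let ?f = "iso_verts h"
  have inj: "inj_on ?f (pverts S)" using h(1) by (simp add: pre_digraph.digraph_isomorphism_def)
  have V: "pverts T = ?f ` pverts S" and A: "parcs T = iso_arcs h ` parcs S"
    and tl: "iso_tail h = fst" and hd: "iso_head h = snd"
    using h(2) by (auto simp: app_iso_def with_proj_def)
  have arc: "iso_arcs h a = (?f (fst a), ?f (snd a))" if "a \<in> parcs S" for a
  proof -
    have "?f (fst a) = fst (iso_arcs h a)" "?f (snd a) = snd (iso_arcs h a)"
      using h(1) that tl hd by (auto simp: pre_digraph.digraph_isomorphism_def)
    then show ?thesis by (metis prod.collapse)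
  qed
  show thesis
  proof (rule that)
    show "bij_betw ?f (pverts S) (pverts T)" using inj V by (simp add: bij_betw_def)
    show "(u, v) \<in> parcs S \<longleftrightarrow> (?f u, ?f v) \<in> parcs T" if uv: "u \<in> pverts S" "v \<in> pverts S" for u v
    proof
      assume "(u, v) \<in> parcs S"
      then show "(?f u, ?f v) \<in> parcs T" using arc[of "(u, v)"] A by force
    next
      assume "(?f u, ?f v) \<in> parcs T"
      then obtain a where a: "a \<in> parcs S" "(?f u, ?f v) = (?f (fst a), ?f (snd a))"
        using A arc by auto
      moreover have "fst a \<in> pverts S" "snd a \<in> pverts S"
        using a(1) in_arcsD1[of "fst a" "snd a"] in_arcsD2[of "fst a" "snd a"] by auto
      ultimately have "fst a = u" "snd a = v" using inj uv by (auto dest: inj_onD)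
      then show "(u, v) \<in> parcs S" using a(1) by (metis prod.collapse)
    qed
  qed
qed

text \<open>The position of a vertex in its block is the number of its in-neighbours within its
  class. Transitivity makes this number increase strictly along arcs, so it runs through an initial
  segment exactly once.\<close>

lemma transitive_blowup_ofI:
  assumes T: "tournament T" and H: "tournament H"
    and h: "h ` pverts T = pverts H"
    and across: "\<And>u v. u \<in> pverts T \<Longrightarrow> v \<in> pverts T \<Longrightarrow> h u \<noteq> h v \<Longrightarrow>
      (u, v) \<in> parcs T \<longleftrightarrow> (h u, h v) \<in> parcs H"
    and within: "\<And>u v w. u \<in> pverts T \<Longrightarrow> v \<in> pverts T \<Longrightarrow> w \<in> pverts T \<Longrightarrow> h u = h v \<Longrightarrow> h v = h w \<Longrightarrow>
      (u, v) \<in> parcs T \<Longrightarrow> (v, w) \<in> parcs T \<Longrightarrow> (u, w) \<in> parcs T"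
  shows "transitive_blowup_of T H"
proof -
  interpret T: tournament T by fact
  interpret H: tournament H by fact
  define C where "C = (\<lambda>x. {v \<in> pverts T. h v = x})"
  define pred where "pred = (\<lambda>v. {u \<in> C (h v). (u, v) \<in> parcs T})"
  define a where "a = (\<lambda>x. card (C x))"
  define f where "f = (\<lambda>v. (h v, card (pred v)))"
  have finC: "finite (C x)" for x by (simp add: C_def)
  have fin: "finite (pred v)" for v by (simp add: pred_def finC)
  have mono: "card (pred u) < card (pred v)"
    if "u \<in> pverts T" "v \<in> pverts T" "h u = h v" "(u, v) \<in> parcs T" for u v
  proof (rule psubset_card_mono[OF fin])
    have "pred u \<subseteq> pred v"
      using that within[of _ u v] by (auto simp: pred_def C_def)
    moreover have "u \<in> pred v" using that by (simp add: pred_def C_def)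
    moreover have "u \<notin> pred u" using T.arcs_asym[of u u] by (auto simp: pred_def)
    ultimately show "pred u \<subset> pred v" by blast
  qed
  have arc_iff: "(u, v) \<in> parcs T \<longleftrightarrow> card (pred u) < card (pred v)"
    if "u \<in> pverts T" "v \<in> pverts T" "h u = h v" for u v
    using mono[OF that] mono[OF that(2,1) that(3)[symmetric]] T.arcs_total[OF that(1,2)]
    by (cases "u = v") auto
  have less: "card (pred v) < a (h v)" if "v \<in> pverts T" for v
    unfolding a_def
  proof (rule psubset_card_mono[OF finC])
    have "v \<in> C (h v)" "v \<notin> pred v" using that T.arcs_asym[of v v] by (auto simp: C_def pred_def)
    then show "pred v \<subset> C (h v)" by (auto simp: pred_def)
  qed
  have inj_class: "inj_on (\<lambda>v. card (pred v)) (C x)" for x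
  proof (rule inj_onI)
    fix u v assume "u \<in> C x" "v \<in> C x" "card (pred u) = card (pred v)"
    then show "u = v" using arc_iff[of u v] arc_iff[of v u] T.arcs_total[of u v] by (auto simp: C_def)
  qed
  have onto: "(\<lambda>v. card (pred v)) ` C x = {..<a x}" for x
  proof (rule card_subset_eq)
    show "(\<lambda>v. card (pred v)) ` C x \<subseteq> {..<a x}" using less by (auto simp: C_def)
    show "card ((\<lambda>v. card (pred v)) ` C x) = card {..<a x}"
      using card_image[OF inj_class] by (simp add: a_def)
  qed simp
  have "isomorphic T (blowup H a)"
  proof (rule isomorphicI[OF T tournament_blowup[OF H]])
    show "bij_betw f (pverts T) (pverts (blowup H a))"
      unfolding bij_betw_def
    proof
      show "inj_on f (pverts T)"
        using inj_class by (auto simp: inj_on_def f_def C_def)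
      show "f ` pverts T = pverts (blowup H a)"
      proof (intro equalityI subsetI)
        fix y assume "y \<in> f ` pverts T"
        then show "y \<in> pverts (blowup H a)" using h less by (auto simp: f_def blowup_def)
      next
        fix y assume "y \<in> pverts (blowup H a)"
        then have "snd y \<in> (\<lambda>v. card (pred v)) ` C (fst y)"
          unfolding onto by (auto simp: blowup_def)
        then show "y \<in> f ` pverts T" by (cases y) (auto simp: f_def C_def)
      qed
    qed
    show "(u, v) \<in> parcs T \<longleftrightarrow> (f u, f v) \<in> parcs (blowup H a)" if "u \<in> pverts T" "v \<in> pverts T" for u v
      using that across[OF that] arc_iff[OF that] less[OF that(1)] less[OF that(2)] h H.arcs_asym[of "h v" "h v"]
      by (cases "h u = h v") (auto simp: f_def blowup_def)
  qed
  moreover have "a x \<ge> 1" if "x \<in> pverts H" for x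
  proof -
    have "x \<in> h ` pverts T" using that h by simp
    then have "C x \<noteq> {}" by (auto simp: C_def)
    then show ?thesis using finC[of x] by (simp add: a_def Suc_le_eq card_gt_0_iff)
  qed
  ultimately show ?thesis unfolding transitive_blowup_of_def by blast
qed

text \<open>The vertices with index 0, one from each nonempty block, induce a copy of
  \<open>H\<close> in the switch; restricting the switching set to them yields the required
  subtournament.\<close>

lemma blowup_in_xi:
  assumes T: "tournament T" and H: "tournament H"
    and sw: "switching_equivalent T T'" and bl: "transitive_blowup_of T' H"
  shows "T \<in> xi H"
proof -
  interpret T: tournament T by fact
  interpret H: tournament H by fact
  obtain W where W: "W \<subseteq> pverts T" "T' = switch T W"
    using sw by (auto simp: switching_equivalent_def)
  obtain a where a: "\<And>x. x \<in> pverts H \<Longrightarrow> a x \<ge> 1" "isomorphic T' (blowup H a)"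
    using bl by (auto simp: transitive_blowup_of_def)
  have T': "tournament T'" using tournament_switch[OF T] W(2) by simp
  obtain f where f: "bij_betw f (pverts T') (pverts (blowup H a))"
    "\<And>u v. u \<in> pverts T' \<Longrightarrow> v \<in> pverts T' \<Longrightarrow> (u, v) \<in> parcs T' \<longleftrightarrow> (f u, f v) \<in> parcs (blowup H a)"
    using isomorphicD[OF a(2) T'] by blast
  have V: "pverts T' = pverts T" by (simp add: W switch_def)
  define A where "A = {v \<in> pverts T. snd (f v) = 0}"
  let ?S = "induced T A"
  have sub: "subtournament ?S T" by (rule subtournament_induced[OF T]) (auto simp: A_def)
  have S: "tournament ?S" by (rule tournament_subtournament[OF T sub])
  have fA: "fst (f v) \<in> pverts H" "f v = (fst (f v), 0)" if "v \<in> A" for v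
  proof -
    have "f v \<in> pverts (blowup H a)" using that f(1) V by (auto simp: A_def bij_betw_def)
    then show "fst (f v) \<in> pverts H" by (auto simp: blowup_def)
    show "f v = (fst (f v), 0)" using that by (simp add: A_def prod_eq_iff)
  qed
  have "isomorphic (switch ?S (W \<inter> A)) H"
  proof (rule isomorphicI[OF tournament_switch[OF S] H])
    show "bij_betw (\<lambda>v. fst (f v)) (pverts (switch ?S (W \<inter> A))) (pverts H)"
      unfolding bij_betw_def
    proof
      have "inj_on f A" using f(1) V by (auto simp: bij_betw_def A_def inj_on_def)
      have "inj_on (\<lambda>v. fst (f v)) A"
      proof (rule inj_onI)
        fix u v assume uv: "u \<in> A" "v \<in> A" "fst (f u) = fst (f v)"
        then have "f u = f v" using fA(2)[OF uv(1)] fA(2)[OF uv(2)] by simp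
        then show "u = v" using \<open>inj_on f A\<close> uv(1,2) by (auto dest: inj_onD)
      qed
      then show "inj_on (\<lambda>v. fst (f v)) (pverts (switch ?S (W \<inter> A)))"
        by (simp add: switch_def induced_def)
      have "x \<in> (\<lambda>v. fst (f v)) ` A" if x: "x \<in> pverts H" for x
      proof -
        have "(x, 0) \<in> pverts (blowup H a)" using x a(1)[OF x] by (simp add: blowup_def)
        also have "pverts (blowup H a) = f ` pverts T" using f(1) V by (simp add: bij_betw_def)
        finally obtain v where v: "v \<in> pverts T" "f v = (x, 0)" by force
        then have "v \<in> A" "x = fst (f v)" by (simp_all add: A_def)
        then show ?thesis by blast
      qed
      then show "(\<lambda>v. fst (f v)) ` pverts (switch ?S (W \<inter> A)) = pverts H"
        using fA(1) by (auto simp: switch_def induced_def)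
    qed
    show "(u, v) \<in> parcs (switch ?S (W \<inter> A)) \<longleftrightarrow> (fst (f u), fst (f v)) \<in> parcs H"
      if uv: "u \<in> pverts (switch ?S (W \<inter> A))" "v \<in> pverts (switch ?S (W \<inter> A))" for u v
    proof -
      have A: "u \<in> A" "v \<in> A" using uv by (simp_all add: switch_def induced_def)
      then have "(u, v) \<in> parcs (switch ?S (W \<inter> A)) \<longleftrightarrow> (u, v) \<in> parcs T'"
        by (auto simp: W switch_def induced_def)
      also have "\<dots> \<longleftrightarrow> ((fst (f u), 0), (fst (f v), 0)) \<in> parcs (blowup H a)"
        using f(2)[of u v] A V fA(2)[OF A(1)] fA(2)[OF A(2)] by (auto simp: A_def)
      also have "\<dots> \<longleftrightarrow> (fst (f u), fst (f v)) \<in> parcs H"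
        using fA(1)[OF A(1)] fA(1)[OF A(2)] a(1) by (auto simp: blowup_def Suc_le_eq)
      finally show ?thesis .
    qed
  qed
  moreover have "switching_equivalent ?S (switch ?S (W \<inter> A))"
    unfolding switching_equivalent_def by (rule exI[of _ "W \<inter> A"]) (simp add: induced_def)
  ultimately show ?thesis using T sub unfolding xi_def switching_isomorphic_def by blast
qed

section \<open>Passing between \<open>core\<close> and \<open>L (k + 1)\<close>\<close>

definition L_label :: "nat \<Rightarrow> nat \<Rightarrow> nat" where
  "L_label k i = (if i = 0 then k + 1 else i)"

definition L_sign :: "nat \<Rightarrow> rat" where
  "L_sign i = (if i = 0 then 1 else (-1) ^ (i + 1))"

lemma L_sign_unit: "L_sign i = 1 \<or> L_sign i = -1"
  by (simp add: L_sign_def minus_one_power_iff)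

lemma L_label_bij: "bij_betw (L_label k) {..k} (pverts (L (k + 1)))"
proof -
  have "L_label k i \<in> {1..k + 1}" if "i \<le> k" for i using that by (auto simp: L_label_def)
  moreover have "j \<in> L_label k ` {..k}" if "j \<in> {1..k + 1}" for j
  proof (cases "j = k + 1")
    case True
    then show ?thesis by (intro image_eqI[of _ _ 0]) (auto simp: L_label_def)
  next
    case False
    then show ?thesis using that by (intro image_eqI[of _ _ j]) (auto simp: L_label_def)
  qed
  moreover have "inj_on (L_label k) {..k}"
    by (auto simp: inj_on_def L_label_def split: if_splits)
  ultimately show ?thesis by (auto simp: bij_betw_def L_def)
qed

text \<open>On the cycle the product of the two values of \<open>L_sign\<close> is (-1)^(i + j),
  which cancels the parity factor of \<open>core\<close> and leaves the transitive order. At the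
  apex it leaves the alternation by parity.\<close>

lemma arc_sign_L:
  assumes "i \<le> k" "j \<le> k"
  shows "arc_sign (L (k + 1)) (L_label k i) (L_label k j) = L_sign i * L_sign j * core i j"
proof -
  have arc: "(u, v) \<in> parcs (L (k + 1)) \<longleftrightarrow>
      1 \<le> u \<and> u < v \<and> v \<le> k \<or> u = k + 1 \<and> 1 \<le> v \<and> v \<le> k \<and> odd v \<or> v = k + 1 \<and> 1 \<le> u \<and> u \<le> k \<and> even u"
    for u v
    by (auto simp: L_def)
  consider "i = 0" "j = 0" | "i = 0" "j \<noteq> 0" | "i \<noteq> 0" "j = 0" | "i \<noteq> 0" "j \<noteq> 0" by blast
  then show ?thesis
  proof cases
    case 1
    then show ?thesis unfolding arc_sign_def arc by (simp add: L_label_def)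
  next
    case 2
    then show ?thesis unfolding arc_sign_def arc using assms
      by (simp add: L_label_def L_sign_def core_def minus_one_power_iff)
  next
    case 3
    then show ?thesis unfolding arc_sign_def arc using assms
      by (simp add: L_label_def L_sign_def core_def minus_one_power_iff)
  next
    case 4
    then have "L_sign i * L_sign j * (-1) ^ (i + j) = 1"
      by (simp add: L_sign_def minus_one_power_iff)
    then have "L_sign i * L_sign j * core i j = (if i = j then 0 else if i < j then 1 else -1)"
      using 4 by (simp add: core_def)
    moreover have "arc_sign (L (k + 1)) (L_label k i) (L_label k j) = (if i = j then 0 else if i < j then 1 else -1)"
      unfolding arc_sign_def arc using 4 assms by (simp add: L_label_def)
    ultimately show ?thesis by simp
  qed
qed

lemma signed_tournament_arc_sign:
  assumes T: "T \<in> tournaments_D k" and k: "odd k" "5 \<le> k"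
  shows "signed_tournament (pverts T) (arc_sign T) k"
proof -
  interpret tournament T using T by (simp add: tournaments_D_def)
  show ?thesis
  proof
    show "arc_sign T u v = - arc_sign T v u" for u v by (rule arc_sign_skew)
  qed (use k in \<open>auto dest: arc_sign_unit intro: fdet_arc_sign_le[OF T]\<close>)
qed

lemma xi_L_embedding:
  assumes T: "tournament T" and xi: "T \<in> xi (L (k + 1))"
  obtains g e where "\<And>v. g v = 1 \<or> g v = -1" "inj_on e {..k}" "e ` {..k} \<subseteq> pverts T"
    "\<And>i j. i \<le> k \<Longrightarrow> j \<le> k \<Longrightarrow> g (e i) * g (e j) * arc_sign T (e i) (e j) = core i j"
proof -
  obtain S W where S: "subtournament S T" and W: "W \<subseteq> pverts S"
    and iso: "isomorphic (switch S W) (L (k + 1))"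
    using xi unfolding xi_def switching_isomorphic_def switching_equivalent_def by blast
  have tS: "tournament S" by (rule tournament_subtournament[OF T S])
  have tS': "tournament (switch S W)" by (rule tournament_switch[OF tS])
  obtain f where f: "bij_betw f (pverts (switch S W)) (pverts (L (k + 1)))"
    "\<And>u v. u \<in> pverts (switch S W) \<Longrightarrow> v \<in> pverts (switch S W) \<Longrightarrow>
      (u, v) \<in> parcs (switch S W) \<longleftrightarrow> (f u, f v) \<in> parcs (L (k + 1))"
    by (rule isomorphicD[OF iso tS']) blast
  have pS: "pverts (switch S W) = pverts S" by (simp add: switch_def)
  define t where "t = (\<lambda>v. the_inv_into {..k} (L_label k) (f v))"
  have bt: "bij_betw t (pverts S) {..k}"
    using bij_betw_trans[OF f(1) bij_betw_the_inv_into[OF L_label_bij]]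
    by (simp add: pS t_def comp_def)
  have lt: "L_label k (t v) = f v" if "v \<in> pverts S" for v
  proof -
    have "f v \<in> L_label k ` {..k}"
      using that f(1) L_label_bij[of k] by (auto simp: bij_betw_def pS)
    then show ?thesis
      using f_the_inv_into_f L_label_bij[of k] unfolding t_def bij_betw_def by metis
  qed
  define e where "e = the_inv_into (pverts S) t"
  have be: "bij_betw e {..k} (pverts S)" unfolding e_def by (rule bij_betw_the_inv_into[OF bt])
  have eS: "e i \<in> pverts S" if "i \<le> k" for i using be that by (auto simp: bij_betw_def)
  have te: "t (e i) = i" if "i \<le> k" for i
    unfolding e_def using bt that by (intro f_the_inv_into_f) (auto simp: bij_betw_def)
  define w where "w = (\<lambda>v. if v \<in> W then -1 else 1 :: rat)"
  \<comment> \<open>\<open>t v\<close> is unspecified outside \<open>pverts S\<close>, but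
    \<open>L_sign\<close> takes only the values 1 and -1, so \<open>g\<close> is a sign on all
    vertices of \<open>T\<close>.\<close>
  define g where "g = (\<lambda>v. w v * L_sign (t v))"
  show thesis
  proof (rule that)
    show "g v = 1 \<or> g v = -1" for v using L_sign_unit[of "t v"] by (auto simp: g_def w_def)
    show "inj_on e {..k}" "e ` {..k} \<subseteq> pverts T"
      using be subtournamentD(1)[OF S] by (auto simp: bij_betw_def)
    show "g (e i) * g (e j) * arc_sign T (e i) (e j) = core i j" if ij: "i \<le> k" "j \<le> k" for i j
    proof -
      have "arc_sign T (e i) (e j) = arc_sign S (e i) (e j)"
        using eS[OF ij(1)] eS[OF ij(2)] subtournamentD(2)[OF S] by (simp add: arc_sign_def)
      then have "w (e i) * w (e j) * arc_sign T (e i) (e j) = arc_sign (switch S W) (e i) (e j)"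
        using arc_sign_switch[OF tS, of W "e i" "e j"] by (simp add: w_def)
      also have "\<dots> = arc_sign (L (k + 1)) (f (e i)) (f (e j))"
        using f(2)[of "e i" "e j"] f(2)[of "e j" "e i"] eS[OF ij(1)] eS[OF ij(2)] by (simp add: arc_sign_def pS)
      also have "\<dots> = L_sign i * L_sign j * core i j"
        using arc_sign_L[OF ij] lt[OF eS[OF ij(1)]] lt[OF eS[OF ij(2)]] te ij by simp
      finally have *: "w (e i) * w (e j) * arc_sign T (e i) (e j) = L_sign i * L_sign j * core i j" .
      have "g (e i) * g (e j) * arc_sign T (e i) (e j)
          = L_sign i * L_sign j * (w (e i) * w (e j) * arc_sign T (e i) (e j))"
        using te ij by (simp add: g_def)
      also have "\<dots> = core i j"
        unfolding * using L_sign_unit[of i] L_sign_unit[of j] by auto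
      finally show ?thesis .
    qed
  qed
qed

lemma xi_imp_blowup:
  assumes k: "odd k" "5 \<le> k" and T: "T \<in> tournaments_D k" and xi: "T \<in> xi (L (k + 1))"
  shows "\<exists>T'. switching_equivalent T T' \<and> transitive_blowup_of T' (L (k + 1))"
proof -
  let ?V = "pverts T"
  have tT: "tournament T" using T by (simp add: tournaments_D_def)
  obtain h e where h: "\<And>v. h v = 1 \<or> h v = -1" and e: "inj_on e {..k}" "e ` {..k} \<subseteq> ?V"
    "\<And>i j. i \<le> k \<Longrightarrow> j \<le> k \<Longrightarrow> h (e i) * h (e j) * arc_sign T (e i) (e j) = core i j"
    by (rule xi_L_embedding[OF tT xi]) blast
  interpret S: signed_tournament ?V "arc_sign T" k by (rule signed_tournament_arc_sign[OF T k])
  interpret R: signed_tournament ?V "\<lambda>u v. h u * h v * arc_sign T u v" k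
    by (rule S.switched[OF h])
  have "R.embeds k e" unfolding R.embeds_def using e by blast
  then obtain g t where g: "\<And>v. v \<in> ?V \<Longrightarrow> g v = 1 \<or> g v = -1"
    and t: "\<And>v. v \<in> ?V \<Longrightarrow> t v \<le> k" "\<And>i. i \<le> k \<Longrightarrow> t (e i) = i"
    and across: "\<And>u v. u \<in> ?V \<Longrightarrow> v \<in> ?V \<Longrightarrow> t u \<noteq> t v \<Longrightarrow>
      g u * g v * (h u * h v * arc_sign T u v) = core (t u) (t v)"
    and within: "\<And>u v w. u \<in> ?V \<Longrightarrow> v \<in> ?V \<Longrightarrow> w \<in> ?V \<Longrightarrow> t u = t v \<Longrightarrow> t u = t w \<Longrightarrow> distinct [u, v, w] \<Longrightarrow>
      \<bar>g u * g v * (h u * h v * arc_sign T u v) + g v * g w * (h v * h w * arc_sign T v w)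
        + g w * g u * (h w * h u * arc_sign T w u)\<bar> \<le> 1"
    by (rule R.blowup_structure) blast
  \<comment> \<open>Three switches are combined: \<open>h\<close> turns the copy into
    \<open>core\<close>, \<open>g\<close> removes the signs of the twins, and \<open>L_sign\<close>
    leads back from \<open>core\<close> to \<open>L (k + 1)\<close>.\<close>
  define s where "s = (\<lambda>v. g v * h v * L_sign (t v))"
  have s: "s v = 1 \<or> s v = -1" if "v \<in> ?V" for v
    using g[OF that] h[of v] L_sign_unit[of "t v"] by (auto simp: s_def)
  define W where "W = {v \<in> ?V. s v = -1}"
  let ?T = "switch T W"
  have tT': "tournament ?T" by (rule tournament_switch[OF tT])
  interpret T': tournament ?T by (rule tT')
  have pT': "pverts ?T = ?V" by (simp add: switch_def)
  have sw: "arc_sign ?T u v = s u * s v * arc_sign T u v" if "u \<in> ?V" "v \<in> ?V" for u v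
    unfolding arc_sign_switch[OF tT] using that s[OF that(1)] s[OF that(2)] by (auto simp: W_def)
  have L: "tournament (L (k + 1))" by (rule tournament_L) (use k in simp)
  have sq: "L_sign i * L_sign i = 1" for i using L_sign_unit[of i] by auto
  have "transitive_blowup_of ?T (L (k + 1))"
  proof (rule transitive_blowup_ofI[OF tT' L, where h = "\<lambda>v. L_label k (t v)"])
    have "t ` ?V = {..k}"
    proof (intro equalityI subsetI)
      fix i assume "i \<in> {..k}"
      then have "i = t (e i)" "e i \<in> ?V" using t(2)[of i] e(2) by auto
      then show "i \<in> t ` ?V" by blast
    qed (use t(1) in auto)
    then show "(\<lambda>v. L_label k (t v)) ` pverts ?T = pverts (L (k + 1))"
      using L_label_bij[of k] unfolding pT' bij_betw_def by (metis image_image)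
  next
    fix u v assume uv: "u \<in> pverts ?T" "v \<in> pverts ?T" "L_label k (t u) \<noteq> L_label k (t v)"
    then have V: "u \<in> ?V" "v \<in> ?V" and ne: "t u \<noteq> t v" by (auto simp: pT')
    have "arc_sign ?T u v = L_sign (t u) * L_sign (t v) * (g u * g v * (h u * h v * arc_sign T u v))"
      unfolding sw[OF V] s_def by simp
    also have "\<dots> = arc_sign (L (k + 1)) (L_label k (t u)) (L_label k (t v))"
      unfolding across[OF V ne] arc_sign_L[OF t(1)[OF V(1)] t(1)[OF V(2)]] ..
    finally show "(u, v) \<in> parcs ?T \<longleftrightarrow> (L_label k (t u), L_label k (t v)) \<in> parcs (L (k + 1))"
      unfolding arc_sign_eq_one[symmetric] by simp
  next
    fix u v w assume uvw: "u \<in> pverts ?T" "v \<in> pverts ?T" "w \<in> pverts ?T"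
      "L_label k (t u) = L_label k (t v)" "L_label k (t v) = L_label k (t w)"
      and arcs: "(u, v) \<in> parcs ?T" "(v, w) \<in> parcs ?T"
    have V: "u \<in> ?V" "v \<in> ?V" "w \<in> ?V" using uvw by (simp_all add: pT')
    have inj: "inj_on (L_label k) {..k}" using L_label_bij[of k] by (simp add: bij_betw_def)
    have eq: "t u = t v" "t u = t w"
      using uvw(4,5) t(1)[OF V(1)] t(1)[OF V(2)] t(1)[OF V(3)] inj_onD[OF inj] by auto
    have d: "distinct [u, v, w]"
      using arcs T'.arcs_asym[of u v] T'.arcs_asym[of v w] by auto
    \<comment> \<open>Within a class both ends have the same \<open>L_sign\<close>, so the return
      from \<open>core\<close> to \<open>L (k + 1)\<close> does not affect these arcs.\<close>
    have tr: "arc_sign ?T x y = g x * g y * (h x * h y * arc_sign T x y)"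
      if "x \<in> ?V" "y \<in> ?V" "t x = t y" for x y
    proof -
      have "arc_sign ?T x y = L_sign (t y) * L_sign (t y) * (g x * g y * (h x * h y * arc_sign T x y))"
        unfolding sw[OF that(1,2)] s_def that(3) by simp
      then show ?thesis unfolding sq by simp
    qed
    \<comment> \<open>Two of the summands are 1, so the third has to be -1, which is the arc that
      transitivity demands.\<close>
    have "\<bar>arc_sign ?T u v + arc_sign ?T v w + arc_sign ?T w u\<bar> \<le> 1"
      using within[OF V eq d] eq by (simp add: tr V)
    moreover have "arc_sign ?T u v = 1" "arc_sign ?T v w = 1"
      using arcs by (simp_all add: arc_sign_eq_one)
    moreover have "arc_sign ?T w u = 1 \<or> arc_sign ?T w u = -1"
      using T'.arc_sign_unit[of w u] uvw d by auto
    ultimately have "arc_sign ?T w u = -1" by auto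
    then have "arc_sign ?T u w = 1" using T'.arc_sign_skew[of u w] by simp
    then show "(u, w) \<in> parcs ?T" by (simp add: arc_sign_eq_one)
  qed
  moreover have "switching_equivalent T ?T"
    unfolding switching_equivalent_def by (intro exI[of _ W]) (auto simp: W_def)
  ultimately show ?thesis by blast
qed

theorem theorem7p1:
  fixes k :: nat and T :: "'a pair_pre_digraph"
  assumes "odd k" and "k \<ge> 7"
    and "T \<in> tournaments_D k - tournaments_D (k - 2)"
  shows "(\<exists>T'. switching_equivalent T T' \<and> transitive_blowup_of T' (L (k + 1)))
           \<longleftrightarrow> T \<in> xi (L (k + 1))"
proof
  have T: "T \<in> tournaments_D k" and "tournament T" using assms(3) by (auto simp: tournaments_D_def)
  have "tournament (L (k + 1))" by (rule tournament_L) (use assms(2) in simp)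
  then show "T \<in> xi (L (k + 1))"
    if "\<exists>T'. switching_equivalent T T' \<and> transitive_blowup_of T' (L (k + 1))"
    using that blowup_in_xi[OF \<open>tournament T\<close>] by blast
  show "\<exists>T'. switching_equivalent T T' \<and> transitive_blowup_of T' (L (k + 1))"
    if "T \<in> xi (L (k + 1))"
    by (rule xi_imp_blowup[OF assms(1) _ T that]) (use assms(2) in simp)
qed

end
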